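(* Every strongly inhomogeneous perfect PQF is inhomogeneous extreme.
   Context: A PQF in $n$ variables is a positive definite real symmetric $n\times n$ matrix $Q$, $Q[x]=x^tQx$. Let $\mu(Q)=\max_{x\in\mathbb{R}^n}\min_{v\in\mathbb{Z}^n}Q[x-v]$ and $\gamma_i(Q)=\mu(Q)/(\det Q)^{1/n}$; $Q$ is inhomogeneous extreme if it is a local maximum of $\gamma_i$ on the cone of positive definite symmetric $n\times n$ matrices. For $c\in\mathbb{R}^n$ attaining $\mu(Q)$ let $\mathrm{Min}_cQ=\{v\in\mathbb{Z}^n: Q[v-c]=\mu(Q)\}$. A finite set $X\subset\mathbb{R}^n$ carries a spherical $t$-design with respect to $Q$ if there are $c\in\mathbb{R}^n$, $r>0$ with $X\subset S_Q(c,r)=\{x: Q[x-c]=r^2\}$ and $\frac{1}{|X|}\sum_{x\in X}p(x)=\int_{S_Q(c,r)}p\,d\omega$ for every polynomial $p$ of degree at most $t$, where $\omega$ is the normalized surface measure on $S_Q(c,r)$ (the image of the normalized rotation-invariant measure on the unit sphere under $y\mapsto c+rQ^{-1/2}y$). $Q$ is strongly inhomogeneous perfect if for each $c$ attaining $\mu(Q)$ the set $\mathrm{Min}_cQ$ carries a spherical $4$-design with respect to $Q$. *)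

theory Defs
  imports "HOL-Probability.Probability"
begin

section \<open>Positive definite quadratic forms and the inhomogeneous minimum\<close>

definition qform :: "real^'n^'n \<Rightarrow> real^'n \<Rightarrow> real" where
  "qform Q x = x \<bullet> (Q *v x)"

definition pqf :: "real^'n^'n \<Rightarrow> bool" where
  "pqf Q \<longleftrightarrow> transpose Q = Q \<and> (\<forall>x. x \<noteq> 0 \<longrightarrow> qform Q x > 0)"

definition int_lattice :: "(real^'n) set" where
  "int_lattice = {v. \<forall>i. v $ i \<in> \<int>}"

text \<open>For a positive definite \<open>Q\<close> the infimum is a minimum and the supremum is a maximum.\<close>

definition dist_lattice :: "real^'n^'n \<Rightarrow> real^'n \<Rightarrow> real" where
  "dist_lattice Q x = (INF v\<in>int_lattice. qform Q (x - v))"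

definition inhom_min :: "real^'n^'n \<Rightarrow> real" where
  "inhom_min Q = (SUP x. dist_lattice Q x)"

definition gamma_i :: "real^'n^'n \<Rightarrow> real" where
  "gamma_i Q = inhom_min Q / root CARD('n) (det Q)"

definition inhomogeneous_extreme :: "real^'n^'n \<Rightarrow> bool" where
  "inhomogeneous_extreme Q \<longleftrightarrow>
     pqf Q \<and> (\<forall>\<^sub>F Q' in at Q within {Q'. pqf Q'}. gamma_i Q' \<le> gamma_i Q)"

definition Min_at :: "real^'n \<Rightarrow> real^'n^'n \<Rightarrow> (real^'n) set" where
  "Min_at c Q = {v \<in> int_lattice. qform Q (v - c) = inhom_min Q}"


section \<open>The surface measure\<close>

text \<open>
  The uniform distribution on the unit ball, projected radially to the unit sphere
  (\<open>sgn x = x / norm x\<close>). The lemmas below show that this is a rotation-invariant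
  probability measure concentrated on the unit sphere.
\<close>

definition sphere_measure :: "'a::euclidean_space measure" where
  "sphere_measure = distr (uniform_measure lborel (ball 0 1)) borel sgn"

lemma sgn_borel_measurable [measurable]: "sgn \<in> borel_measurable (borel :: 'a::euclidean_space measure)"
  unfolding sgn_div_norm[abs_def] by measurable

lemma emeasure_ball_neq: "emeasure lborel (ball (0::'a::euclidean_space) 1) \<noteq> 0"
  "emeasure lborel (ball (0::'a::euclidean_space) 1) \<noteq> \<infinity>"
proof -
  show "emeasure lborel (ball (0::'a) 1) \<noteq> 0"
    by (metis content_ball_pos emeasure_eq_ennreal_measure measure_def ennreal_0 enn2real_eq_0_iff
        less_irrefl zero_less_one measure_completion sets_lborel borel_open open_ball)
  show "emeasure lborel (ball (0::'a) 1) \<noteq> \<infinity>"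
    using emeasure_lborel_ball_finite[of "0::'a" 1] by auto
qed

lemma sets_sphere_measure [simp, measurable_cong]: "sets sphere_measure = sets borel"
  by (simp add: sphere_measure_def)

lemma prob_space_uniform_ball:
  "prob_space (uniform_measure lborel (ball (0::'a::euclidean_space) 1))"
  by (intro prob_space_uniform_measure emeasure_ball_neq)

lemma prob_space_sphere_measure: "prob_space sphere_measure"
  unfolding sphere_measure_def
  by (rule prob_space.prob_space_distr[OF prob_space_uniform_ball]) measurable

lemma emeasure_sphere_measure_sphere:
  "emeasure sphere_measure (sphere (0::'a::euclidean_space) 1) = 1"
proof -
  let ?B = "ball (0::'a) 1" and ?V = "sgn -` sphere (0::'a) 1 :: 'a set"
  have V: "?V = - {0}" by (auto simp: norm_sgn)
  have "emeasure sphere_measure (sphere (0::'a) 1) = emeasure (uniform_measure lborel ?B) ?V"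
    unfolding sphere_measure_def by (subst emeasure_distr) auto
  also have "\<dots> = emeasure lborel (?B - {0}) / emeasure lborel ?B"
    unfolding V by (subst emeasure_uniform_measure) (auto simp: Diff_eq)
  also have "emeasure lborel (?B - {0}) = emeasure lborel ?B"
    by (subst emeasure_Diff) auto
  also have "emeasure lborel ?B / emeasure lborel ?B = 1"
    using emeasure_ball_neq[where 'a='a] by (intro ennreal_divide_self) (auto simp: less_top)
  finally show ?thesis .
qed

lemma lborel_distr_orthogonal:
  fixes f :: "'a::euclidean_space \<Rightarrow> 'a"
  assumes f: "orthogonal_transformation f"
  shows "distr lborel borel f = lborel"
proof (rule measure_eqI)
  fix A :: "'a set" assume "A \<in> sets (distr lborel borel f)"
  then have A [measurable]: "A \<in> sets borel" by simp
  have lin: "linear f" using f by (rule orthogonal_transformation_linear)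
  have [measurable]: "f \<in> borel_measurable borel"
    using lin by (intro borel_measurable_continuous_onI linear_continuous_on) (simp add: linear_conv_bounded_linear)
  have [measurable]: "f -` A \<in> sets borel"
    using measurable_sets_borel[OF _ A, of f] by auto
  have fA: "(\<integral>\<^sup>+x. indicator A (f x) \<partial>lborel) = emeasure lborel (f -` A)"
    using nn_integral_indicator[of "f -` A" lborel] by (simp add: indicator_def)
  let ?B = "ball (0::'a) 1"
  have [measurable]: "?B \<in> sets borel" by simp
  have pre: "indicator ?B (f x) = (indicator ?B x :: ennreal)" for x
    using orthogonal_transformation_norm[OF f, of x] by (simp add: indicator_def)
  have tr: "(\<integral>\<^sup>+y. g (y + a) \<partial>lborel) = (\<integral>\<^sup>+y. g y \<partial>lborel)"
    if [measurable]: "g \<in> borel_measurable borel" for g :: "'a \<Rightarrow> ennreal" and a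
    by (subst (2) lborel_distr_plus[symmetric, of a], subst nn_integral_distr) (auto simp: add.commute)
  have neg: "(\<integral>\<^sup>+y. g (- y) \<partial>lborel) = (\<integral>\<^sup>+y. g y \<partial>lborel)"
    if [measurable]: "g \<in> borel_measurable borel" for g :: "'a \<Rightarrow> ennreal"
  proof -
    have "lborel = distr lborel borel (uminus :: 'a \<Rightarrow> 'a)"
      by (subst lborel_affine[of "-1" "0::'a"]) (simp_all add: density_1 one_ennreal_def[symmetric])
    then show ?thesis
      using nn_integral_distr[of uminus lborel borel g] by simp
  qed
  have surj: "\<exists>w. f w = y" for y
    using orthogonal_transformation_surj[OF f] by (metis surjD)
  have "emeasure lborel (f -` A) * emeasure lborel ?B
      = (\<integral>\<^sup>+x. indicator A (f x) * (\<integral>\<^sup>+y. indicator ?B y \<partial>lborel) \<partial>lborel)"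
    by (subst nn_integral_multc) (auto simp: fA)
  also have "\<dots> = (\<integral>\<^sup>+x. \<integral>\<^sup>+y. indicator A (f x) * indicator ?B (y - f x) \<partial>lborel \<partial>lborel)"
  proof (rule nn_integral_cong)
    fix x
    have [measurable]: "(\<lambda>y. indicator ?B (y - f x) :: ennreal) \<in> borel_measurable lborel"
      by (rule measurable_compose[of "\<lambda>y. y - f x" _ borel])
         (simp, rule borel_measurable_indicator, simp)
    have "(\<integral>\<^sup>+y. indicator A (f x) * indicator ?B (y - f x) \<partial>lborel)
        = indicator A (f x) * (\<integral>\<^sup>+y. indicator ?B (y - f x) \<partial>lborel)"
      by (rule nn_integral_cmult) measurable
    then show "indicator A (f x) * (\<integral>\<^sup>+y. indicator ?B y \<partial>lborel)
        = (\<integral>\<^sup>+y. indicator A (f x) * indicator ?B (y - f x) \<partial>lborel)"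
      using tr[of "indicator ?B" "- f x"] by simp
  qed
  also have "\<dots> = (\<integral>\<^sup>+y. \<integral>\<^sup>+x. indicator A (f x) * indicator ?B (y - f x) \<partial>lborel \<partial>lborel)"
    by (rule lborel_pair.Fubini') measurable
  also have "\<dots> = (\<integral>\<^sup>+y. \<integral>\<^sup>+x. indicator A (y - f x) * indicator ?B x \<partial>lborel \<partial>lborel)"
  proof (rule nn_integral_cong)
    fix y :: 'a
    obtain w where w: "f w = y" using surj by blast
    define h :: "'a \<Rightarrow> ennreal" where "h x = indicator A (f x) * indicator ?B (y - f x)" for x
    have [measurable]: "h \<in> borel_measurable borel" unfolding h_def by measurable
    have shift: "(\<integral>\<^sup>+x. h x \<partial>lborel) = (\<integral>\<^sup>+x. h (- x + w) \<partial>lborel)"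
      using tr[of h w] neg[of "\<lambda>x. h (x + w)"] by simp
    have "h (- x + w) = indicator A (y - f x) * indicator ?B x" for x
      using w by (simp add: h_def linear_diff[OF lin] pre)
    with shift show "(\<integral>\<^sup>+x. indicator A (f x) * indicator ?B (y - f x) \<partial>lborel)
        = (\<integral>\<^sup>+x. indicator A (y - f x) * indicator ?B x \<partial>lborel)"
      by (simp add: h_def)
  qed
  also have "\<dots> = (\<integral>\<^sup>+x. \<integral>\<^sup>+y. indicator A (y - f x) * indicator ?B x \<partial>lborel \<partial>lborel)"
    by (rule lborel_pair.Fubini') measurable
  also have "\<dots> = (\<integral>\<^sup>+x. (\<integral>\<^sup>+y. indicator A y \<partial>lborel) * indicator ?B x \<partial>lborel)"
    using tr[of "indicator A" "- f x" for x]
    by (subst nn_integral_multc) auto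
  also have "\<dots> = emeasure lborel A * emeasure lborel ?B"
    by (subst nn_integral_cmult) auto
  finally have "emeasure lborel (f -` A) = emeasure lborel A"
    using emeasure_ball_neq[where 'a='a]
    by (auto simp: mult.commute[of _ "emeasure lborel (ball (0::'a) 1)"] ennreal_mult_cancel_left)
  then show "emeasure (distr lborel borel f) A = emeasure lborel A"
    by (subst emeasure_distr) auto
qed simp

lemma sphere_measure_rotation_invariant:
  fixes f :: "'a::euclidean_space \<Rightarrow> 'a"
  assumes f: "orthogonal_transformation f"
  shows "distr sphere_measure borel f = sphere_measure"
proof (rule measure_eqI)
  fix A :: "'a set" assume "A \<in> sets (distr sphere_measure borel f)"
  then have A [measurable]: "A \<in> sets borel" by simp
  have lin: "linear f" using f by (rule orthogonal_transformation_linear)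
  have [measurable]: "f \<in> borel_measurable borel"
    using lin by (intro borel_measurable_continuous_onI linear_continuous_on) (simp add: linear_conv_bounded_linear)
  let ?B = "ball (0::'a) 1"
  have eq: "emeasure sphere_measure C = emeasure lborel (?B \<inter> sgn -` C) / emeasure lborel ?B"
    if [measurable]: "C \<in> sets borel" for C :: "'a set"
  proof -
    have [measurable]: "sgn -` C \<in> sets borel" using measurable_sets_borel[OF sgn_borel_measurable that] .
    show ?thesis unfolding sphere_measure_def by (subst emeasure_distr) auto
  qed
  have sgn: "sgn (f x) = f (sgn x)" for x
    by (simp add: sgn_div_norm orthogonal_transformation_norm[OF f] linear_scale[OF lin])
  have [measurable]: "f -` A \<in> sets borel" "sgn -` A \<in> sets borel"
    using measurable_sets_borel[OF _ A, of f] measurable_sets_borel[OF sgn_borel_measurable A] by auto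
  have "emeasure lborel (?B \<inter> sgn -` A) = emeasure (distr lborel borel f) (?B \<inter> sgn -` A)"
    by (simp add: lborel_distr_orthogonal[OF f])
  also have "\<dots> = emeasure lborel (f -` (?B \<inter> sgn -` A))"
    by (subst emeasure_distr) auto
  also have "f -` (?B \<inter> sgn -` A) = ?B \<inter> sgn -` (f -` A)"
    by (auto simp: orthogonal_transformation_norm[OF f] sgn)
  finally have "emeasure sphere_measure (f -` A) = emeasure sphere_measure A"
    by (simp add: eq)
  then show "emeasure (distr sphere_measure borel f) A = emeasure sphere_measure A"
    by (subst emeasure_distr) (auto simp: sets_eq_imp_space_eq[OF sets_sphere_measure])
qed simp

text \<open>The unique positive definite square root of a positive definite matrix.\<close>

definition pd_sqrt :: "real^'n^'n \<Rightarrow> real^'n^'n" where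
  "pd_sqrt Q = (THE R. pqf R \<and> R ** R = Q)"

definition qsphere :: "real^'n^'n \<Rightarrow> real^'n \<Rightarrow> real \<Rightarrow> (real^'n) set" where
  "qsphere Q c r = {x. qform Q (x - c) = r\<^sup>2}"

definition qsphere_measure :: "real^'n^'n \<Rightarrow> real^'n \<Rightarrow> real \<Rightarrow> (real^'n) measure" where
  "qsphere_measure Q c r =
     distr sphere_measure borel (\<lambda>y. c + r *\<^sub>R (matrix_inv (pd_sqrt Q) *v y))"


section \<open>Spherical designs\<close>

definition multi_indices :: "nat \<Rightarrow> ('n::finite \<Rightarrow> nat) set" where
  "multi_indices t = {\<alpha>. (\<Sum>i\<in>UNIV. \<alpha> i) \<le> t}"

lemma finite_multi_indices: "finite (multi_indices t :: ('n::finite \<Rightarrow> nat) set)"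
proof (rule finite_subset)
  show "multi_indices t \<subseteq> (UNIV :: 'n set) \<rightarrow>\<^sub>E {..t}"
    unfolding multi_indices_def
    by (auto simp: PiE_UNIV_domain intro: order_trans[OF member_le_sum[of _ UNIV]])
qed (auto intro!: finite_PiE)

definition polyfun_le :: "nat \<Rightarrow> (real^'n \<Rightarrow> real) \<Rightarrow> bool" where
  "polyfun_le t p \<longleftrightarrow>
     (\<exists>a. p = (\<lambda>x. \<Sum>\<alpha>\<in>multi_indices t. a \<alpha> * (\<Prod>i\<in>UNIV. (x $ i) ^ \<alpha> i)))"

definition carries_spherical_design :: "nat \<Rightarrow> real^'n^'n \<Rightarrow> (real^'n) set \<Rightarrow> bool" where
  "carries_spherical_design t Q X \<longleftrightarrow> finite X \<and>
     (\<exists>c r. r > 0 \<and> X \<subseteq> qsphere Q c r \<and>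
        (\<forall>p. polyfun_le t p \<longrightarrow>
           (1 / real (card X)) * (\<Sum>x\<in>X. p x) = (\<integral>x. p x \<partial>qsphere_measure Q c r)))"

definition strongly_inhomogeneous_perfect :: "real^'n^'n \<Rightarrow> bool" where
  "strongly_inhomogeneous_perfect Q \<longleftrightarrow>
     pqf Q \<and> (\<forall>c. dist_lattice Q c = inhom_min Q \<longrightarrow> carries_spherical_design 4 Q (Min_at c Q))"

end

theory Submission
  imports Defs
begin

text \<open>Write \<open>Q = R\<^sup>2\<close> and let \<open>\<mu>\<close> be attained at \<open>c\<close>. The map \<open>v \<mapsto> R (v - c) / \<surd>\<mu>\<close> turns
  \<open>Min\<^sub>c Q\<close> into a 4-design \<open>Y\<close> on the unit sphere, and a form near \<open>Q\<close> into a multiple of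
  \<open>1 + H\<close> with \<open>tr H = 0\<close>. For a point near \<open>c\<close>, the least value of \<open>(1 + H)[\<eta> - y]\<close>
  over \<open>Y\<close> is at most any mean with positive weights. Suitable weights of degree 2 in \<open>y\<close> make
  this mean \<open>1 - C \<parallel>H\<parallel>\<^sup>2\<close>, with \<open>C\<close> as large as we like if \<open>H\<close> is small, hence at most
  \<open>det (1 + H)\<close>. Where \<open>\<mu>\<close> is not attained, continuity suffices, and compactness of the unit
  cube makes the neighbourhood of \<open>Q\<close> uniform.\<close>

section \<open>Polynomial functions\<close>

lemma polyfun_le_monomial:
  assumes "\<alpha> \<in> multi_indices t"
  shows "polyfun_le t (\<lambda>x::real^'n. c * (\<Prod>i\<in>UNIV. (x $ i) ^ \<alpha> i))"
  unfolding polyfun_le_def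
proof (intro exI[of _ "\<lambda>\<beta>. if \<beta> = \<alpha> then c else 0"] ext)
  fix x :: "real^'n"
  have "(\<Sum>\<beta>\<in>multi_indices t. (if \<beta> = \<alpha> then c else 0) * (\<Prod>i\<in>UNIV. (x $ i) ^ \<beta> i)) =
    (\<Sum>\<beta>\<in>multi_indices t. if \<beta> = \<alpha> then c * (\<Prod>i\<in>UNIV. (x $ i) ^ \<beta> i) else 0)"
    by (intro sum.cong) auto
  also have "\<dots> = c * (\<Prod>i\<in>UNIV. (x $ i) ^ \<alpha> i)"
    using assms by (simp add: finite_multi_indices)
  finally show "c * (\<Prod>i\<in>UNIV. (x $ i) ^ \<alpha> i) =
    (\<Sum>\<beta>\<in>multi_indices t. (if \<beta> = \<alpha> then c else 0) * (\<Prod>i\<in>UNIV. (x $ i) ^ \<beta> i))" by simp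
qed

lemma polyfun_le_const: "polyfun_le t (\<lambda>x::real^'n. c)"
  using polyfun_le_monomial[of "\<lambda>i::'n. 0" t c] by (simp add: multi_indices_def)

lemma polyfun_le_add:
  assumes "polyfun_le t p" "polyfun_le t q"
  shows "polyfun_le t (\<lambda>x. p x + q x)"
proof -
  obtain a b where "p = (\<lambda>x. \<Sum>\<alpha>\<in>multi_indices t. a \<alpha> * (\<Prod>i\<in>UNIV. (x $ i) ^ \<alpha> i))"
    "q = (\<lambda>x. \<Sum>\<alpha>\<in>multi_indices t. b \<alpha> * (\<Prod>i\<in>UNIV. (x $ i) ^ \<alpha> i))"
    using assms unfolding polyfun_le_def by blast
  then show ?thesis unfolding polyfun_le_def
    by (intro exI[of _ "\<lambda>\<alpha>. a \<alpha> + b \<alpha>"]) (simp add: sum.distrib distrib_right)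
qed

lemma polyfun_le_sum:
  assumes "\<And>j. j \<in> J \<Longrightarrow> polyfun_le t (p j)"
  shows "polyfun_le t (\<lambda>x. \<Sum>j\<in>J. p j x)"
  using assms by (induction J rule: infinite_finite_induct)
    (auto intro: polyfun_le_const polyfun_le_add)

lemma polyfun_le_mult:
  assumes "polyfun_le s p" "polyfun_le t q"
  shows "polyfun_le (s + t) (\<lambda>x. p x * q x)"
proof -
  obtain a b where p: "p = (\<lambda>x. \<Sum>\<alpha>\<in>multi_indices s. a \<alpha> * (\<Prod>i\<in>UNIV. (x $ i) ^ \<alpha> i))"
    and q: "q = (\<lambda>x. \<Sum>\<alpha>\<in>multi_indices t. b \<alpha> * (\<Prod>i\<in>UNIV. (x $ i) ^ \<alpha> i))"
    using assms unfolding polyfun_le_def by blast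
  have "(\<lambda>x. p x * q x) = (\<lambda>x. \<Sum>\<alpha>\<in>multi_indices s. \<Sum>\<beta>\<in>multi_indices t.
      (a \<alpha> * b \<beta>) * (\<Prod>i\<in>UNIV. (x $ i) ^ (\<alpha> i + \<beta> i)))"
    unfolding p q sum_product by (simp add: power_add prod.distrib mult_ac)
  \<comment> \<open>Distinct pairs of exponents can have the same sum, so the double sum is not in
    the normal form of \<open>polyfun_le\<close>; it is treated as a sum of monomials.\<close>
  moreover have "polyfun_le (s + t) \<dots>"
    by (intro polyfun_le_sum polyfun_le_monomial) (auto simp: multi_indices_def sum.distrib)
  ultimately show ?thesis by simp
qed

lemma polyfun_le_cmult: "polyfun_le t p \<Longrightarrow> polyfun_le t (\<lambda>x. c * p x)"
  using polyfun_le_mult[OF polyfun_le_const[of 0]] by simp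

lemma polyfun_le_diff:
  "polyfun_le t p \<Longrightarrow> polyfun_le t q \<Longrightarrow> polyfun_le t (\<lambda>x. p x - q x)"
  using polyfun_le_add[of t p "\<lambda>x. (-1) * q x"] polyfun_le_cmult[of t q "-1"] by simp

lemma polyfun_le_mono:
  assumes "polyfun_le s p" "s \<le> t"
  shows "polyfun_le t p"
proof -
  obtain a where p: "p = (\<lambda>x. \<Sum>\<alpha>\<in>multi_indices s. a \<alpha> * (\<Prod>i\<in>UNIV. (x $ i) ^ \<alpha> i))"
    using assms unfolding polyfun_le_def by blast
  show ?thesis unfolding p
    by (intro polyfun_le_sum polyfun_le_monomial) (use assms in \<open>auto simp: multi_indices_def\<close>)
qed

lemma polyfun_le_nth: "polyfun_le 1 (\<lambda>x::real^'n. x $ i)"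
proof -
  have "(\<Prod>j\<in>UNIV. (x $ j) ^ (if j = i then 1 else 0)) = x $ i" for x :: "real^'n"
  proof -
    have "(\<Prod>j\<in>UNIV. (x $ j) ^ (if j = i then 1 else 0)) = (\<Prod>j\<in>UNIV. if j = i then x $ j else 1)"
      by (intro prod.cong) auto
    then show ?thesis by simp
  qed
  then show ?thesis
    using polyfun_le_monomial[of "\<lambda>j. if j = i then 1 else 0" 1 1] by (simp add: multi_indices_def)
qed

lemma polyfun_le_power:
  assumes "polyfun_le s p"
  shows "polyfun_le (s * k) (\<lambda>x. p x ^ k)"
  by (induction k) (use polyfun_le_const[of 0 1] polyfun_le_mult[OF assms] in auto)

lemma polyfun_le_prod:
  assumes "finite J" "\<And>j. j \<in> J \<Longrightarrow> polyfun_le (d j) (p j)"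
  shows "polyfun_le (\<Sum>j\<in>J. d j) (\<lambda>x. \<Prod>j\<in>J. p j x)"
  using assms by (induction J rule: finite_induct)
    (auto intro: polyfun_le_const polyfun_le_mult)

text \<open>Affine substitution keeps the degree. This allows test polynomials to be moved from the
  ellipsoid to the unit sphere and to be composed with orthogonal maps.\<close>

lemma polyfun_le_compose:
  assumes "polyfun_le t p" "\<And>i. polyfun_le 1 (\<lambda>x. g x $ i)"
  shows "polyfun_le t (\<lambda>x. p (g x))"
proof -
  obtain a where p: "p = (\<lambda>x. \<Sum>\<alpha>\<in>multi_indices t. a \<alpha> * (\<Prod>i\<in>UNIV. (x $ i) ^ \<alpha> i))"
    using assms unfolding polyfun_le_def by blast
  have "polyfun_le t (\<lambda>x. \<Prod>i\<in>UNIV. (g x $ i) ^ \<alpha> i)" if "\<alpha> \<in> multi_indices t" for \<alpha>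
    by (rule polyfun_le_mono[OF polyfun_le_prod[where d = \<alpha>]])
      (use polyfun_le_power[OF assms(2)] that in \<open>auto simp: multi_indices_def\<close>)
  then show ?thesis unfolding p
    by (intro polyfun_le_sum polyfun_le_cmult)
qed

lemma polyfun_le_linear:
  fixes f :: "real^'n \<Rightarrow> real"
  assumes "linear f"
  shows "polyfun_le 1 f"
proof -
  have "f = (\<lambda>x. \<Sum>i\<in>UNIV. f (axis i 1) * x $ i)"
  proof
    fix x :: "real^'n"
    have "f x = f (\<Sum>i\<in>UNIV. x $ i *\<^sub>R axis i 1)"
      using basis_expansion[of x] by (simp add: scalar_mult_eq_scaleR)
    then show "f x = (\<Sum>i\<in>UNIV. f (axis i 1) * x $ i)"
      by (simp add: linear_sum[OF assms] linear_scale[OF assms] mult.commute)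
  qed
  moreover have "polyfun_le 1 \<dots>" by (intro polyfun_le_sum polyfun_le_cmult polyfun_le_nth)
  ultimately show ?thesis by simp
qed

lemma continuous_on_polyfun: "polyfun_le t p \<Longrightarrow> continuous_on UNIV p"
  unfolding polyfun_le_def by (auto intro!: continuous_intros)

lemma qform_eq_sum: "qform Q x = (\<Sum>i\<in>UNIV. \<Sum>j\<in>UNIV. Q $ i $ j * (x $ i * x $ j))"
  unfolding qform_def inner_vec_def matrix_vector_mult_def
  by (simp add: sum_distrib_left mult_ac)

lemma polyfun_le_qform: "polyfun_le 2 (qform Q)"
proof -
  have "polyfun_le (1 + 1) (\<lambda>x. \<Sum>i\<in>UNIV. \<Sum>j\<in>UNIV. Q $ i $ j * (x $ i * x $ j))"
    by (intro polyfun_le_sum polyfun_le_cmult polyfun_le_mult polyfun_le_nth)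
  then show ?thesis by (simp add: qform_eq_sum[abs_def] numeral_2_eq_2)
qed

section \<open>Moments of a spherical 4-design\<close>

text \<open>Invariance of the sums under all orthogonal maps stands in for the comparison with an
  integral: together with \<open>unit\<close>, a few special orthogonal maps determine the second
  and fourth moments by pure algebra.\<close>

locale sphere_design =
  fixes Y :: "(real^'n) set"
  assumes fin: "finite Y" and ne: "Y \<noteq> {}"
    and unit: "\<And>y. y \<in> Y \<Longrightarrow> norm y = 1"
    and inv: "\<And>p f. polyfun_le 4 p \<Longrightarrow> orthogonal_transformation f \<Longrightarrow>
      (\<Sum>y\<in>Y. p (f y)) = (\<Sum>y\<in>Y. p y)"
begin

abbreviation "N \<equiv> real (card Y)"

lemma N_pos: "N > 0" using fin ne by (simp add: card_gt_0_iff)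

text \<open>The antipodal map is orthogonal, so the sum equals its own negative.\<close>

lemma sum_odd:
  assumes "polyfun_le 4 p" "\<And>y. p (- y) = - p y"
  shows "(\<Sum>y\<in>Y. p y) = 0"
  using inv[OF assms(1), of uminus] orthogonal_transformation_neg[of "\<lambda>x::real^'n. x"]
  by (simp add: assms(2) sum_negf)

lemma nth4: "polyfun_le 4 (\<lambda>y::real^'n. y $ i * y $ j * y $ k * y $ l)"
  using polyfun_le_mono[OF polyfun_le_mult[OF polyfun_le_mult[OF polyfun_le_mult[OF
    polyfun_le_nth polyfun_le_nth] polyfun_le_nth] polyfun_le_nth], of 4 i j k l] by simp

lemma nth2: "polyfun_le 4 (\<lambda>y::real^'n. y $ i * y $ j)"
  using polyfun_le_mono[OF polyfun_le_mult[OF polyfun_le_nth polyfun_le_nth], of 4 i j] by simp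

lemma sum_unit: "(\<Sum>i\<in>UNIV. y $ i * y $ i) = 1" if "y \<in> Y"
  using unit[OF that] by (simp add: norm_eq_sqrt_inner inner_vec_def)

section \<open>Orthogonal maps that probe the moments\<close>

lemma orthogonal_signs:
  assumes "\<And>k. s k * s k = 1"
  shows "orthogonal_transformation (\<lambda>y::real^'n. \<chi> k. s k * y $ k)"
proof -
  have "(s k * v) * (s k * w) = v * w" for k v w
  proof -
    have "(s k * v) * (s k * w) = (s k * s k) * (v * w)" by (simp only: mult_ac)
    then show ?thesis by (simp only: assms mult_1)
  qed
  then have "(\<chi> k. s k * v $ k) \<bullet> (\<chi> k. s k * w $ k) = v \<bullet> w" for v w :: "real^'n"
    by (simp only: inner_vec_def vec_lambda_beta inner_real_def)
  moreover have "linear (\<lambda>y::real^'n. \<chi> k. s k * y $ k)"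
    by (simp add: linear_iff vec_eq_iff distrib_left)
  ultimately show ?thesis unfolding orthogonal_transformation_def by blast
qed

lemma orthogonal_perm:
  "orthogonal_transformation (\<lambda>y::real^'n. \<chi> k. y $ Transposition.transpose a b k)"
proof -
  have "(\<Sum>i\<in>UNIV. v $ Transposition.transpose a b i * w $ Transposition.transpose a b i)
     = (\<Sum>i\<in>UNIV. v $ i * w $ i)" for v w :: "real^'n"
    by (rule sum.reindex_bij_witness[of _ "Transposition.transpose a b" "Transposition.transpose a b"]) auto
  then show ?thesis
    unfolding orthogonal_transformation_def
    by (auto simp: linear_iff vec_eq_iff inner_vec_def algebra_simps)
qed

text \<open>For \<open>a \<noteq> b\<close>, this is a reflection in the plane of the two
  coordinates that sends the axis \<open>a\<close> to the diagonal. Sign changes and permutations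
  alone do not relate fourth powers to products of two squares; this map does.\<close>

definition half :: "'n \<Rightarrow> 'n \<Rightarrow> real^'n \<Rightarrow> real^'n" where
  "half a b y = (\<chi> k. if k = a then (y $ a + y $ b) / sqrt 2
     else if k = b then (y $ a - y $ b) / sqrt 2 else y $ k)"

lemma orthogonal_half:
  assumes "a \<noteq> b"
  shows "orthogonal_transformation (half a b)"
proof -
  have *: "(\<Sum>i\<in>UNIV. g i) = g a + g b + (\<Sum>i\<in>UNIV - {a, b}. g i)" for g :: "'n \<Rightarrow> real"
    using assms by (subst sum.subset_diff[of "{a, b}"]) auto
  have "half a b v \<bullet> half a b w = v \<bullet> w" for v w
    unfolding inner_vec_def * using assms by (simp add: half_def field_simps)
  moreover have "linear (half a b)"
    by (auto simp: half_def linear_iff vec_eq_iff field_simps)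
  ultimately show ?thesis unfolding orthogonal_transformation_def by blast
qed

text \<open>A sign change in one coordinate kills the mixed moments, transpositions make the
  diagonal ones equal, and these add up to \<open>N\<close> because the points are unit
  vectors.\<close>

lemma moment2: "(\<Sum>y\<in>Y. y $ i * y $ j) = (if i = j then N / real CARD('n) else 0)"
proof (cases "i = j")
  case False
  then show ?thesis using inv[OF nth2[of i j] orthogonal_signs[of "\<lambda>k. if k = i then - 1 else 1"]]
    by (simp add: sum_negf)
next
  case True
  have e: "(\<Sum>y\<in>Y. y $ k * y $ k) = (\<Sum>y\<in>Y. y $ i * y $ i)" for k
    using inv[OF nth2[of i i] orthogonal_perm[of i k]] by simp
  have "(\<Sum>k\<in>UNIV. \<Sum>y\<in>Y. y $ k * y $ k) = (\<Sum>k\<in>(UNIV :: 'n set). \<Sum>y\<in>Y. y $ i * y $ i)"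
    
  proof (rule sum.cong[OF refl])
    fix k show "(\<Sum>y\<in>Y. y $ k * y $ k) = (\<Sum>y\<in>Y. y $ i * y $ i)" by (rule e)
  qed
  then have "(\<Sum>k\<in>UNIV. \<Sum>y\<in>Y. y $ k * y $ k) = real CARD('n) * (\<Sum>y\<in>Y. y $ i * y $ i)"
    by simp
  moreover have "(\<Sum>k\<in>UNIV. \<Sum>y\<in>Y. y $ k * y $ k) = N"
    by (subst sum.swap) (simp add: sum_unit)
  ultimately show ?thesis using True by (simp add: field_simps)
qed

lemma moment4_signs:
  assumes "\<And>k. s k * s k = 1"
  shows "(\<Sum>y\<in>Y. y $ i * y $ j * y $ k * y $ l) =
    s i * s j * s k * s l * (\<Sum>y\<in>Y. y $ i * y $ j * y $ k * y $ l)"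
  using inv[OF nth4[of i j k l] orthogonal_signs[of s, OF assms]]
  by (simp add: sum_distrib_left mult_ac)

text \<open>Applying \<open>half i k\<close> turns the product of the squares of coordinates
  \<open>i\<close> and \<open>k\<close> into a quarter of the squared difference of these squares.
  Hence each mixed moment is a third of the pure one. Summing over one index reduces to the second
  moment and fixes the scale.\<close>

lemma moment4_pair:
  "(\<Sum>y\<in>Y. y $ i * y $ i * y $ j * y $ j) = N / (real CARD('n) * (real CARD('n) + 2)) * (if i = j then 3 else 1)"
proof -
  define P where "P i j = (\<Sum>y\<in>Y. y $ i * y $ i * y $ j * y $ j)" for i j
  have diag: "P k k = P i i" for k
    using inv[OF nth4[of i i i i] orthogonal_perm[of i k]] by (simp add: P_def)
  have off: "P i k = P i i / 3" if "i \<noteq> k" for k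
  proof -
    have half4: "half i k y $ i * half i k y $ i * half i k y $ k * half i k y $ k =
      (y $ i * y $ i * y $ i * y $ i + y $ k * y $ k * y $ k * y $ k
        - 2 * (y $ i * y $ i * y $ k * y $ k)) / 4" for y
      using that by (simp add: half_def field_simps)
    have "P i k = (\<Sum>y\<in>Y. half i k y $ i * half i k y $ i * half i k y $ k * half i k y $ k)"
      using inv[OF nth4[of i i k k] orthogonal_half[OF that]] by (simp add: P_def)
    also have "\<dots> = (P i i + P k k - 2 * P i k) / 4"
      unfolding half4 P_def
      by (simp add: sum_divide_distrib[symmetric] sum.distrib sum_subtractf sum_distrib_left)
    finally have "P i k = (P i i + P k k - 2 * P i k) / 4" .
    then show ?thesis using diag[of k] by simp
  qed
  have "(\<Sum>k\<in>UNIV. P i k) = P i i + (\<Sum>k\<in>UNIV - {i}. P i k)" by (simp add: sum.remove)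
  also have "(\<Sum>k\<in>UNIV - {i}. P i k) = (\<Sum>k\<in>UNIV - {i}. P i i / 3)"
    by (intro sum.cong) (auto simp: off)
  also have "\<dots> = (real CARD('n) - 1) * (P i i / 3)" by (simp add: of_nat_diff)
  finally have 1: "(\<Sum>k\<in>UNIV. P i k) = (real CARD('n) + 2) * P i i / 3" by (simp add: field_simps)
  have "(\<Sum>k\<in>UNIV. P i k) = (\<Sum>y\<in>Y. y $ i * y $ i * (\<Sum>k\<in>UNIV. y $ k * y $ k))"
    unfolding P_def by (subst sum.swap) (simp add: sum_distrib_left mult_ac)
  also have "\<dots> = N / real CARD('n)" using moment2[of i i] by (simp add: sum_unit)
  finally have "(real CARD('n) + 2) * P i i / 3 = N / real CARD('n)" using 1 by simp
  then have "P i i * (real CARD('n) + 2) = 3 * (N / real CARD('n))" by (simp only: mult.commute)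
  then have "P i i = 3 * (N / real CARD('n)) / (real CARD('n) + 2)"
    by (rule nonzero_eq_divide_eq[THEN iffD2, rotated]) (simp add: add_nonneg_eq_0_iff)
  then have "P i i = 3 * N / (real CARD('n) * (real CARD('n) + 2))" by simp
  then show ?thesis using off[of j] unfolding P_def[symmetric] by auto
qed

text \<open>If the four indices do not match up in pairs, some value occurs an odd number of times
  among them, and a sign change there annihilates the moment. When all indices coincide, the three
  pairings together give the factor 3.\<close>

lemma moment4:
  "(\<Sum>y\<in>Y. y $ i * y $ j * y $ k * y $ l) = N / (real CARD('n) * (real CARD('n) + 2)) *
    ((if i = j \<and> k = l then 1 else 0) + (if i = k \<and> j = l then 1 else 0)
      + (if i = l \<and> j = k then 1 else 0))"
proof (cases "(i = j \<and> k = l) \<or> (i = k \<and> j = l) \<or> (i = l \<and> j = k)")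
  case True
  then show ?thesis
  proof (elim disjE conjE)
    assume [simp]: "i = j" "k = l"
    show ?thesis using moment4_pair[of j l] by auto
  next
    assume [simp]: "i = k" "j = l"
    show ?thesis using moment4_pair[of k l] by (auto simp: mult_ac)
  next
    assume [simp]: "i = l" "j = k"
    show ?thesis using moment4_pair[of k l] by (auto simp: mult_ac)
  qed
next
  case False
  then have "(\<Sum>y\<in>Y. y $ i * y $ j * y $ k * y $ l) = 0"
  proof -
    \<comment> \<open>The sign acquired by the monomial is -1 to the number of indices equal to
      \<open>a\<close>; an odd count makes the sum its own negative.\<close>
    have flip: "S = 0" if "S = (if i = a then -1 else 1) * (if j = a then -1 else 1) *
        (if k = a then -1 else 1) * (if l = a then -1 else 1) * S"
      "odd (of_bool (i = a) + of_bool (j = a) + of_bool (k = a) + of_bool (l = a) :: nat)"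
      for a and S :: real using that by (auto split: if_splits)
    have "\<exists>a. odd (of_bool (i = a) + of_bool (j = a) + of_bool (k = a) + of_bool (l = a) :: nat)"
    proof (cases "i = j")
      case True
      with False show ?thesis by (intro exI[of _ "if k = i then l else k"]) auto
    next
      case ij: False
      \<comment> \<open>With \<open>i \<noteq> j\<close>, the value \<open>i\<close> occurs three
        times if \<open>k = l = i\<close> and once if neither equals \<open>i\<close>. If exactly
        one does, the other differs from \<open>j\<close>, so \<open>j\<close> occurs once.\<close>
      with False show ?thesis by (intro exI[of _ "if k = i then (if l = i then i else j)
        else if l = i then j else i"]) auto
    qed
    then obtain a where a: "odd (of_bool (i = a) + of_bool (j = a) + of_bool (k = a) + of_bool (l = a) :: nat)"
      by blast
    have sq: "(if b = a then -1 else 1) * (if b = a then -1 else 1) = (1::real)" for b by simp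
    show ?thesis
      by (rule flip[OF moment4_signs[of "\<lambda>b. if b = a then -1 else 1", OF sq] a])
  qed
  moreover have "\<not> (i = j \<and> k = l)" "\<not> (i = k \<and> j = l)" "\<not> (i = l \<and> j = k)"
    using False by blast+
  ultimately show ?thesis by (simp only: if_False add_0 mult_zero_right)
qed

section \<open>Moments of linear and quadratic forms\<close>

lemma sum_inner: "(\<Sum>y\<in>Y. u \<bullet> y) = 0"
  by (rule sum_odd[OF polyfun_le_mono[OF polyfun_le_linear]])
    (auto intro: bounded_linear.linear bounded_linear_inner_right)

lemma sum_inner_inner: "(\<Sum>y\<in>Y. (u \<bullet> y) * (w \<bullet> y)) = N / real CARD('n) * (u \<bullet> w)"
proof -
  have "(\<Sum>y\<in>Y. (u \<bullet> y) * (w \<bullet> y)) = (\<Sum>y\<in>Y. \<Sum>i\<in>UNIV. \<Sum>j\<in>UNIV. u $ i * w $ j * (y $ i * y $ j))"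
    by (simp add: inner_vec_def sum_product mult_ac)
  also have "\<dots> = (\<Sum>i\<in>UNIV. \<Sum>j\<in>UNIV. u $ i * w $ j * (\<Sum>y\<in>Y. y $ i * y $ j))"
    unfolding sum_distrib_left by (subst sum.swap, rule sum.cong[OF refl], rule sum.swap)
  also have "\<dots> = N / real CARD('n) * (u \<bullet> w)"
    by (simp add: moment2 inner_vec_def sum_distrib_left mult_ac if_distrib cong: if_cong)
  finally show ?thesis .
qed

lemma sum_inner_qform: "(\<Sum>y\<in>Y. (u \<bullet> y) * qform H y) = 0"
proof (rule sum_odd)
  show "polyfun_le 4 (\<lambda>y. (u \<bullet> y) * qform H y)"
    by (rule polyfun_le_mono[OF polyfun_le_mult[OF polyfun_le_linear polyfun_le_qform]])
      (auto intro: bounded_linear.linear bounded_linear_inner_right)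
  show "u \<bullet> - y * qform H (- y) = - (u \<bullet> y * qform H y)" for y
    by (simp add: qform_eq_sum)
qed

lemma sum_qform: "(\<Sum>y\<in>Y. qform H y) = N / real CARD('n) * trace H"
proof -
  have "(\<Sum>y\<in>Y. qform H y) = (\<Sum>i\<in>UNIV. \<Sum>j\<in>UNIV. H $ i $ j * (\<Sum>y\<in>Y. y $ i * y $ j))"
    unfolding sum_distrib_left qform_eq_sum
    by (subst sum.swap, rule sum.cong[OF refl], rule sum.swap)
  then show ?thesis
    by (simp add: moment2 trace_def sum_distrib_left mult_ac if_distrib cong: if_cong)
qed

text \<open>Of the three pairings in \<open>moment4\<close>, the one within each factor gives the
  squared trace. The two across the factors each give the squared Frobenius norm, one of them by
  symmetry of \<open>H\<close>.\<close>

lemma sum_qform_qform: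
  assumes "transpose H = H"
  shows "(\<Sum>y\<in>Y. (qform H y)\<^sup>2) = N / (real CARD('n) * (real CARD('n) + 2)) *
    ((trace H)\<^sup>2 + 2 * (\<Sum>i\<in>UNIV. \<Sum>j\<in>UNIV. (H $ i $ j)\<^sup>2))"
proof -
  define c where "c = N / (real CARD('n) * (real CARD('n) + 2))"
  have sym: "H $ i $ j = H $ j $ i" for i j
    using arg_cong[OF assms, of "\<lambda>M. M $ j $ i"] by (simp add: transpose_def)
  let ?f = "\<lambda>i j k l. H $ i $ j * H $ k $ l"
  have pointwise: "?f i j k l * (\<Sum>y\<in>Y. y $ i * y $ j * y $ k * y $ l) =
    c * ((if i = j \<and> k = l then ?f i j k l else 0) + (if i = k \<and> j = l then ?f i j k l else 0)
          + (if i = l \<and> j = k then ?f i j k l else 0))" for i j k l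
  proof -
    have "x * (c * ((if P then 1 else 0) + (if Q then 1 else 0) + (if R then 1 else 0)))
      = c * ((if P then x else 0) + (if Q then x else 0) + (if R then x else 0))" for x P Q R
      by (simp add: distrib_left)
    then show ?thesis unfolding moment4 c_def[symmetric] .
  qed
  \<comment> \<open>Expanding with \<open>sum_product\<close> interleaves the two index pairs, hence
    the order \<open>i\<close>, \<open>k\<close>, \<open>j\<close>, \<open>l\<close>.\<close>
  have "(qform H y)\<^sup>2 = (\<Sum>i\<in>UNIV. \<Sum>k\<in>UNIV. \<Sum>j\<in>UNIV. \<Sum>l\<in>UNIV.
      ?f i j k l * (y $ i * y $ j * y $ k * y $ l))" for y
    unfolding qform_eq_sum power2_eq_square sum_product
    by (intro sum.cong refl) (simp add: mult_ac)
  then have "(\<Sum>y\<in>Y. (qform H y)\<^sup>2) = (\<Sum>i\<in>UNIV. \<Sum>k\<in>UNIV. \<Sum>j\<in>UNIV. \<Sum>l\<in>UNIV.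
      ?f i j k l * (\<Sum>y\<in>Y. y $ i * y $ j * y $ k * y $ l))"
    by (simp only: sum.swap[where A = Y] sum_distrib_left[symmetric])
  also have "\<dots> = (\<Sum>i\<in>UNIV. \<Sum>k\<in>UNIV. \<Sum>j\<in>UNIV. \<Sum>l\<in>UNIV.
        c * ((if i = j \<and> k = l then ?f i j k l else 0) + (if i = k \<and> j = l then ?f i j k l else 0)
          + (if i = l \<and> j = k then ?f i j k l else 0)))"
    by (simp only: pointwise)
  also have "\<dots> = c * ((\<Sum>i\<in>UNIV. \<Sum>k\<in>UNIV. \<Sum>j\<in>UNIV. \<Sum>l\<in>UNIV.
        if i = j \<and> k = l then ?f i j k l else 0)
      + (\<Sum>i\<in>UNIV. \<Sum>k\<in>UNIV. \<Sum>j\<in>UNIV. \<Sum>l\<in>UNIV. if i = k \<and> j = l then ?f i j k l else 0)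
      + (\<Sum>i\<in>UNIV. \<Sum>k\<in>UNIV. \<Sum>j\<in>UNIV. \<Sum>l\<in>UNIV. if i = l \<and> j = k then ?f i j k l else 0))"
    unfolding sum_distrib_left[symmetric] sum.distrib ..
  also have "(\<Sum>i\<in>UNIV. \<Sum>k\<in>UNIV. \<Sum>j\<in>UNIV. \<Sum>l\<in>UNIV. if i = j \<and> k = l then ?f i j k l else 0)
      = (trace H)\<^sup>2"
  proof -
    have "(\<Sum>l\<in>UNIV. if i = j \<and> k = l then ?f i j k l else 0) =
      (if j = i then H $ i $ i * H $ k $ k else 0)" for i j k
      by (cases "i = j") simp_all
    then show ?thesis by (simp add: trace_def power2_eq_square sum_product)
  qed
  also have "(\<Sum>i\<in>UNIV. \<Sum>k\<in>UNIV. \<Sum>j\<in>UNIV. \<Sum>l\<in>UNIV. if i = k \<and> j = l then ?f i j k l else 0)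
      = (\<Sum>i\<in>UNIV. \<Sum>j\<in>UNIV. (H $ i $ j)\<^sup>2)"
  proof -
    have "(\<Sum>j\<in>UNIV. \<Sum>l\<in>UNIV. if i = k \<and> j = l then ?f i j k l else 0) =
      (if k = i then \<Sum>j\<in>UNIV. (H $ i $ j)\<^sup>2 else 0)" for i k
      by (cases "i = k") (simp_all add: power2_eq_square)
    then show ?thesis by simp
  qed
  also have "(\<Sum>i\<in>UNIV. \<Sum>k\<in>UNIV. \<Sum>j\<in>UNIV. \<Sum>l\<in>UNIV. if i = l \<and> j = k then ?f i j k l else 0)
      = (\<Sum>i\<in>UNIV. \<Sum>j\<in>UNIV. (H $ i $ j)\<^sup>2)"
  proof -
    have "(\<Sum>l\<in>UNIV. if i = l \<and> j = k then ?f i j k l else 0) =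
      (if j = k then (H $ i $ j)\<^sup>2 else 0)" for i j k
      using sym[of j i] by (cases "j = k") (simp_all add: power2_eq_square)
    then show ?thesis by simp
  qed
  finally show ?thesis by (simp add: c_def)
qed

end

section \<open>The positive definite square root\<close>

lemma symmetric_inner_swap:
  fixes Q :: "real^'n^'n"
  assumes "transpose Q = Q"
  shows "x \<bullet> (Q *v y) = (Q *v x) \<bullet> y"
  using dot_lmul_matrix[of x Q y] transpose_matrix_vector[of Q x] assms by simp

text \<open>A maximiser \<open>x\<close> of the form on the compact unit sphere of \<open>S\<close>
  is an eigenvector, with the maximum as eigenvalue: otherwise a small move along the residual would
  exceed the maximum.\<close>

lemma symmetric_eigenvector_exists:
  fixes Q :: "real^'n^'n"
  assumes Q: "transpose Q = Q" and S: "subspace S" "S \<noteq> {0}"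
    and inv: "\<And>x. x \<in> S \<Longrightarrow> Q *v x \<in> S"
  shows "\<exists>x\<in>S. norm x = 1 \<and> (\<exists>l. Q *v x = l *\<^sub>R x)"
proof -
  let ?K = "S \<inter> sphere 0 1"
  obtain z where z: "z \<in> S" "z \<noteq> 0" using S subspace_0 by blast
  have "z /\<^sub>R norm z \<in> ?K" using z S by (auto simp: subspace_scale)
  moreover have "compact ?K" by (intro closed_Int_compact closed_subspace S) simp
  moreover have "continuous_on ?K (qform Q)"
    unfolding qform_def by (intro continuous_intros)
  ultimately obtain x where x: "x \<in> ?K" and max: "\<And>y. y \<in> ?K \<Longrightarrow> qform Q y \<le> qform Q x"
    using continuous_attains_sup[of ?K "qform Q"] by blast
  define l where "l = qform Q x"
  have xS: "x \<in> S" "norm x = 1" using x by auto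
  have le: "qform Q y \<le> l * (y \<bullet> y)" if "y \<in> S" for y
  proof (cases "y = 0")
    case False
    have "y /\<^sub>R norm y \<in> ?K" using False that S by (auto simp: subspace_scale)
    from max[OF this] have "qform Q y / (norm y)\<^sup>2 \<le> l"
      by (simp add: qform_def l_def matrix_vector_mult_scaleR power2_eq_square divide_inverse mult_ac)
    then show ?thesis using False by (simp add: field_simps dot_square_norm)
  qed (simp add: qform_def)
  \<comment> \<open>The residual is itself the test direction; it stays in \<open>S\<close> by
    invariance. Along \<open>x + t y\<close>, the slack in \<open>le\<close> has no constant term
    and its linear coefficient is \<open>2 * (y \<bullet> y)\<close>.\<close>
  define y where "y = l *\<^sub>R x - Q *v x"
  have yS: "y \<in> S" unfolding y_def using xS inv S by (auto intro: subspace_diff subspace_scale)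
  define b where "b = l * (y \<bullet> y) - qform Q y"
  have nonneg: "0 \<le> 2 * t * (y \<bullet> y) + t\<^sup>2 * b" for t
  proof -
    have "x + t *\<^sub>R y \<in> S" using xS yS S by (auto intro: subspace_add subspace_scale)
    from le[OF this] have "0 \<le> l * ((x + t *\<^sub>R y) \<bullet> (x + t *\<^sub>R y)) - qform Q (x + t *\<^sub>R y)" by simp
    also have "qform Q (x + t *\<^sub>R y) = l + 2 * t * ((Q *v x) \<bullet> y) + t\<^sup>2 * qform Q y"
      using symmetric_inner_swap[OF Q, of x y]
      by (simp add: qform_def l_def matrix_vector_right_distrib matrix_vector_mult_scaleR
        inner_add_left inner_add_right power2_eq_square algebra_simps inner_commute)
    also have "(x + t *\<^sub>R y) \<bullet> (x + t *\<^sub>R y) = 1 + 2 * t * (x \<bullet> y) + t\<^sup>2 * (y \<bullet> y)"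
      using xS(2) by (simp add: inner_add_left inner_add_right power2_eq_square algebra_simps
        inner_commute norm_eq_1)
    finally have "0 \<le> l * (1 + 2 * t * (x \<bullet> y) + t\<^sup>2 * (y \<bullet> y))
      - (l + 2 * t * ((Q *v x) \<bullet> y) + t\<^sup>2 * qform Q y)" .
    also have "\<dots> = 2 * t * (l * (x \<bullet> y) - (Q *v x) \<bullet> y) + t\<^sup>2 * b"
      unfolding b_def by (simp add: algebra_simps)
    also have "l * (x \<bullet> y) - (Q *v x) \<bullet> y = (l *\<^sub>R x - Q *v x) \<bullet> y"
      by (simp add: inner_diff_left)
    also have "\<dots> = y \<bullet> y" by (simp only: y_def[symmetric])
    finally show ?thesis .
  qed
  have "y \<bullet> y = 0"
  proof (rule ccontr)
    assume "y \<bullet> y \<noteq> 0"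
    then have pos: "y \<bullet> y > 0" using inner_ge_zero[of y] by linarith
    \<comment> \<open>Negative, and so small that the linear term outweighs \<open>b\<close>; the
      slack would then be negative.\<close>
    define t where "t = - (y \<bullet> y) / (\<bar>b\<bar> + 1)"
    have t: "t < 0" using pos by (simp add: t_def field_simps)
    have "- t * b \<le> y \<bullet> y"
    proof -
      have "(y \<bullet> y) * b \<le> (y \<bullet> y) * (\<bar>b\<bar> + 1)" using pos by (intro mult_left_mono) auto
      then show ?thesis by (simp add: t_def field_simps)
    qed
    then have "2 * (y \<bullet> y) + t * b > 0" using pos by linarith
    then have "t * (2 * (y \<bullet> y) + t * b) < 0" using t by (simp add: mult_neg_pos)
    then show False using nonneg[of t] by (simp add: power2_eq_square algebra_simps)
  qed
  then have "Q *v x = l *\<^sub>R x" by (simp add: y_def)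
  then show ?thesis using xS by blast
qed

text \<open>Induction on the dimension: symmetry makes the orthogonal complement of an eigenvector
  within \<open>S\<close> invariant again, and it is a proper subspace.\<close>

lemma symmetric_eigenbasis_subspace:
  fixes Q :: "real^'n^'n"
  assumes Q: "transpose Q = Q"
  shows "subspace S \<Longrightarrow> (\<And>x. x \<in> S \<Longrightarrow> Q *v x \<in> S) \<Longrightarrow>
    \<exists>B l. finite B \<and> pairwise orthogonal B \<and> span B = S \<and>
      (\<forall>b\<in>B. norm b = 1 \<and> Q *v b = l b *\<^sub>R b)"
proof (induction "dim S" arbitrary: S rule: less_induct)
  case less
  show ?case
  proof (cases "S = {0}")
    case True
    then show ?thesis by (intro exI[of _ "{}"]) auto
  next
    case False
    obtain x m where x: "x \<in> S" "norm x = 1" "Q *v x = m *\<^sub>R x"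
      using symmetric_eigenvector_exists[OF Q less.prems(1) False less.prems(2)] by blast
    define T where "T = {y \<in> S. orthogonal x y}"
    have T: "subspace T"
      using subspace_inter[OF less.prems(1) subspace_orthogonal_to_vector[of x]]
      by (simp add: T_def Int_def)
    have "x \<notin> T" using x(2) by (auto simp: T_def orthogonal_def norm_eq_1)
    then have "T \<subset> S" using x(1) by (auto simp: T_def)
    then have "dim T < dim S"
      using dim_psubset[of T S] T less.prems(1) by (metis span_eq_iff)
    moreover have "Q *v y \<in> T" if "y \<in> T" for y
      using that less.prems(2) symmetric_inner_swap[OF Q, of x y] x(3)
      by (auto simp: T_def orthogonal_def)
    ultimately obtain B l where B: "finite B" "pairwise orthogonal B" "span B = T"
        "\<forall>b\<in>B. norm b = 1 \<and> Q *v b = l b *\<^sub>R b"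
      using less.hyps[OF _ T] by blast
    have BT: "B \<subseteq> T" using B(3) span_superset by blast
    then have "x \<notin> B" using \<open>x \<notin> T\<close> by auto
    have "span (insert x B) = S"
    proof
      show "span (insert x B) \<subseteq> S"
        using BT x(1) less.prems(1) by (intro span_minimal) (auto simp: T_def)
      show "S \<subseteq> span (insert x B)"
      proof
        fix y assume y: "y \<in> S"
        have "y - (x \<bullet> y) *\<^sub>R x \<in> T"
          using y x less.prems(1)
          by (auto simp: T_def orthogonal_def inner_diff_right norm_eq_1 intro: subspace_diff subspace_scale)
        then have "y - (x \<bullet> y) *\<^sub>R x \<in> span (insert x B)"
          using B(3) span_mono[of B "insert x B"] by blast
        moreover have "(x \<bullet> y) *\<^sub>R x \<in> span (insert x B)" by (intro span_scale span_base) simp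
        ultimately show "y \<in> span (insert x B)" using span_add by fastforce
      qed
    qed
    moreover have "pairwise orthogonal (insert x B)"
      using B(2) BT by (auto simp: pairwise_insert T_def orthogonal_commute)
    moreover have "\<forall>b\<in>insert x B. norm b = 1 \<and> Q *v b = (l(x := m)) b *\<^sub>R b"
      using B(4) x \<open>x \<notin> B\<close> by auto
    ultimately show ?thesis using B(1)
      by (intro exI[of _ "insert x B"] exI[of _ "l(x := m)"]) simp
  qed
qed

lemma pqf_eigenbasis:
  fixes Q :: "real^'n^'n"
  assumes "pqf Q"
  obtains B l where "finite B" "pairwise orthogonal B" "span B = UNIV"
    "\<And>b. b \<in> B \<Longrightarrow> norm b = 1" "\<And>b. b \<in> B \<Longrightarrow> Q *v b = l b *\<^sub>R b" "\<And>b. b \<in> B \<Longrightarrow> l b > 0"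
proof -
  obtain B l where B: "finite B" "pairwise orthogonal B" "span B = UNIV"
    "\<forall>b\<in>B. norm b = 1 \<and> Q *v b = l b *\<^sub>R b"
    using symmetric_eigenbasis_subspace[of Q UNIV] assms unfolding pqf_def by auto
  have "l b > 0" if "b \<in> B" for b
  proof -
    have "b \<noteq> 0" using B(4) that by force
    then have "qform Q b > 0" using assms unfolding pqf_def by blast
    then show ?thesis using B(4) that by (auto simp: qform_def norm_eq_1)
  qed
  with B that show ?thesis by blast
qed

text \<open>The difference \<open>R b - sqrt l b\<close>, if nonzero, would be an eigenvector of
  \<open>R\<close> for the negative value \<open>- sqrt l\<close>. So a positive definite root is
  determined on eigenvectors of \<open>Q\<close>, which gives uniqueness.\<close>

lemma pqf_sqrt_eigenvector:
  fixes Q R :: "real^'n^'n"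
  assumes R: "pqf R" "R ** R = Q" and b: "Q *v b = l *\<^sub>R b" "l > 0"
  shows "R *v b = sqrt l *\<^sub>R b"
proof (rule ccontr)
  assume ne: "R *v b \<noteq> sqrt l *\<^sub>R b"
  define z where "z = R *v b - sqrt l *\<^sub>R b"
  have "R *v (R *v b) = l *\<^sub>R b" using R(2) b by (simp add: matrix_vector_mul_assoc)
  then have "R *v z = - sqrt l *\<^sub>R z"
    using b(2) by (simp add: z_def matrix_vector_mult_diff_distrib matrix_vector_mult_scaleR algebra_simps)
  then have "qform R z = - sqrt l * (z \<bullet> z)" by (simp add: qform_def)
  moreover have "z \<noteq> 0" using ne by (simp add: z_def)
  then have "qform R z > 0" "z \<bullet> z > 0" using R by (auto simp: pqf_def)
  ultimately show False using b(2) by (smt (verit) mult_nonneg_nonneg mult_minus_left real_sqrt_gt_zero)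
qed

lemma pd_sqrt_exists_unique:
  fixes Q :: "real^'n^'n"
  assumes "pqf Q"
  shows "\<exists>!R. pqf R \<and> R ** R = Q"
proof -
  obtain B l where B: "finite B" "pairwise orthogonal B" "span B = UNIV"
    "\<And>b. b \<in> B \<Longrightarrow> norm b = 1" "\<And>b. b \<in> B \<Longrightarrow> Q *v b = l b *\<^sub>R b" "\<And>b. b \<in> B \<Longrightarrow> l b > 0"
    using pqf_eigenbasis[OF assms] by blast
  have eq: "M = M'" if "\<And>b. b \<in> B \<Longrightarrow> M *v b = M' *v b" for M M' :: "real^'n^'n"
  proof -
    have "M *v z = M' *v z" for z
      by (rule linear_eq_on_span[of "(*v) M" "(*v) M'" B]) (use that B(3) in auto)
    then show ?thesis by (simp add: matrix_eq)
  qed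
  \<comment> \<open>The spectral formula: the component along each \<open>b\<close> is scaled by the
    root of its eigenvalue.\<close>
  define f where "f z = (\<Sum>b\<in>B. (sqrt (l b) * (b \<bullet> z)) *\<^sub>R b)" for z
  have lin: "linear f"
    by (rule linearI)
      (simp_all add: f_def inner_add_right algebra_simps sum.distrib scaleR_sum_right)
  define R where "R = matrix f"
  have R: "R *v z = f z" for z using lin by (simp add: R_def matrix_works)
  have fb: "f b = sqrt (l b) *\<^sub>R b" if "b \<in> B" for b
  proof -
    have "f b = (\<Sum>b'\<in>B. if b' = b then sqrt (l b) *\<^sub>R b else 0)"
      unfolding f_def using that B(2,4)
      by (intro sum.cong) (auto simp: pairwise_def orthogonal_def norm_eq_1)
    then show ?thesis using that B(1) by simp
  qed
  have "R ** R = Q"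
  proof (rule eq)
    fix b assume b: "b \<in> B"
    have "R ** R *v b = f (f b)" by (simp add: matrix_vector_mul_assoc[symmetric] R)
    also have "\<dots> = l b *\<^sub>R b" using fb[OF b] B(6)[OF b] by (simp add: linear_scale[OF lin])
    finally show "R ** R *v b = Q *v b" using B(5)[OF b] by simp
  qed
  moreover have "pqf R"
    unfolding pqf_def
  proof (intro conjI allI impI)
    have "(R *v x) \<bullet> y = x \<bullet> (R *v y)" for x y
      unfolding R f_def by (simp add: inner_sum_left inner_sum_right inner_commute mult_ac)
    then show "transpose R = R"
      by (metis (no_types, lifting) dot_lmul_matrix matrix_eq transpose_matrix_vector vector_eq_rdot)
    fix x :: "real^'n" assume x: "x \<noteq> 0"
    have q: "qform R x = (\<Sum>b\<in>B. sqrt (l b) * (b \<bullet> x)\<^sup>2)"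
      unfolding qform_def R f_def by (simp add: inner_sum_right inner_commute power2_eq_square mult_ac)
    have "\<exists>b\<in>B. b \<bullet> x \<noteq> 0"
    proof (rule ccontr)
      assume "\<not> ?thesis"
      then have "orthogonal x x"
        using orthogonal_to_span[of x B x] B(3) by (auto simp: orthogonal_def inner_commute)
      then show False using x by (simp add: orthogonal_def)
    qed
    then obtain b where "b \<in> B" "b \<bullet> x \<noteq> 0" by blast
    then show "qform R x > 0" unfolding q
      using B(1,6) by (intro sum_pos2[of _ b]) (auto intro!: mult_nonneg_nonneg intro: less_imp_le)
  qed
  moreover have "R' = R" if "pqf R'" "R' ** R' = Q" for R'
    by (rule eq) (use pqf_sqrt_eigenvector[OF that] fb B R in auto)
  ultimately show ?thesis by blast
qed

lemma pd_sqrt: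
  assumes "pqf Q"
  shows "pqf (pd_sqrt Q)" "pd_sqrt Q ** pd_sqrt Q = Q"
  using theI'[OF pd_sqrt_exists_unique[OF assms]] unfolding pd_sqrt_def by auto

lemma pqf_invertible:
  fixes Q :: "real^'n^'n"
  assumes "pqf Q"
  shows "invertible Q"
proof -
  have "x = 0" if "Q *v x = 0" for x
    using assms that by (auto simp: pqf_def qform_def)
  then show ?thesis
    unfolding invertible_left_inverse by (subst matrix_left_invertible_ker) blast
qed

lemma pqf_det_pos:
  fixes Q :: "real^'n^'n"
  assumes "pqf Q"
  shows "det Q > 0"
proof -
  have "det Q = (det (pd_sqrt Q))\<^sup>2"
    using pd_sqrt(2)[OF assms] det_mul by (metis power2_eq_square)
  moreover have "det (pd_sqrt Q) \<noteq> 0"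
    using pqf_invertible[OF pd_sqrt(1)[OF assms]] by (simp add: invertible_det_nz)
  ultimately show ?thesis by simp
qed

section \<open>The determinant near the identity\<close>

text \<open>For \<open>\<bar>h\<bar> \<le> 1/2\<close>, \<open>ln (1 + h)\<close> is at least
  \<open>h - 2 * h^2\<close>. Multiplying the exponentials and using
  \<open>exp x \<ge> 1 + x\<close> gives the bound.\<close>

lemma prod_one_plus_ge:
  fixes h :: "'a \<Rightarrow> real"
  assumes "\<And>i. i \<in> I \<Longrightarrow> \<bar>h i\<bar> \<le> 1/2" and "finite I"
  shows "(\<Prod>i\<in>I. 1 + h i) \<ge> 1 + (\<Sum>i\<in>I. h i) - 2 * (\<Sum>i\<in>I. (h i)\<^sup>2)"
proof -
  have "exp (h i - 2 * (h i)\<^sup>2) \<le> 1 + h i" if "i \<in> I" for i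
  proof -
    have "h i - 2 * (h i)\<^sup>2 \<le> ln (1 + h i)"
      using abs_ln_one_plus_x_minus_x_bound[OF assms(1)[OF that]] by linarith
    then have "exp (h i - 2 * (h i)\<^sup>2) \<le> exp (ln (1 + h i))" by simp
    then show ?thesis using assms(1)[OF that] by simp
  qed
  then have "(\<Prod>i\<in>I. exp (h i - 2 * (h i)\<^sup>2)) \<le> (\<Prod>i\<in>I. 1 + h i)"
    by (intro prod_mono) auto
  moreover have "(\<Prod>i\<in>I. exp (h i - 2 * (h i)\<^sup>2)) = exp (\<Sum>i\<in>I. h i - 2 * (h i)\<^sup>2)"
    using assms(2) by (simp add: exp_sum)
  moreover have "exp (\<Sum>i\<in>I. h i - 2 * (h i)\<^sup>2) \<ge> 1 + (\<Sum>i\<in>I. h i - 2 * (h i)\<^sup>2)" by simp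
  ultimately show ?thesis unfolding sum_subtractf sum_distrib_left by linarith
qed

text \<open>In the Leibniz formula, the identity contributes at least \<open>1 - 2 * F\<close>,
  since its linear part is the trace. Any other permutation moves two indices, which gives two
  off-diagonal factors of size at most \<open>sqrt F\<close>; the remaining factors are at most 2. A
  crude constant suffices, because the weights below can be tuned to any constant.\<close>

lemma det_one_plus_ge:
  fixes H :: "real^'n^'n"
  assumes small: "\<And>i j. \<bar>H $ i $ j\<bar> \<le> 1/2" and tr: "trace H = 0"
  defines "F \<equiv> \<Sum>i\<in>UNIV. \<Sum>j\<in>UNIV. (H $ i $ j)\<^sup>2"
  shows "det (mat 1 + H) \<ge> 1 - (2 + fact CARD('n) * 2 ^ CARD('n)) * F"
proof -
  let ?A = "mat 1 + H"
  have entry: "(H $ i $ j)\<^sup>2 \<le> F" for i j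
  proof -
    have "(H $ i $ j)\<^sup>2 \<le> (\<Sum>j\<in>UNIV. (H $ i $ j)\<^sup>2)" by (rule member_le_sum) auto
    also have "\<dots> \<le> F" unfolding F_def
      by (rule member_le_sum[of i UNIV "\<lambda>i. \<Sum>j\<in>UNIV. (H $ i $ j)\<^sup>2"]) (auto intro: sum_nonneg)
    finally show ?thesis .
  qed
  have F0: "F \<ge> 0" unfolding F_def by (intro sum_nonneg) auto
  have abs_entry: "\<bar>H $ i $ j\<bar> \<le> sqrt F" for i j
    using real_le_rsqrt[of "\<bar>H $ i $ j\<bar>" F] entry[of i j] by simp
  define P where "P = {p::'n \<Rightarrow> 'n. p permutes UNIV}"
  have finP: "finite P" unfolding P_def by (rule finite_permutations) simp
  define T where "T p = of_int (sign p) * (\<Prod>i\<in>UNIV. ?A $ i $ p i)" for p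
  have idP: "id \<in> P" by (simp add: P_def permutes_id)
  have off: "T p \<ge> - (2 ^ CARD('n) * F)" if p: "p \<in> P - {id}" for p
  proof -
    obtain i where i: "p i \<noteq> i" using p by (auto simp: fun_eq_iff)
    \<comment> \<open>By injectivity \<open>p\<close> moves \<open>p i\<close> as well, which yields
      the second off-diagonal factor.\<close>
    define j where "j = p i"
    have inj: "inj p" using p permutes_inj by (auto simp: P_def)
    have j: "p j \<noteq> j" "i \<noteq> j" using i inj by (auto simp: j_def inj_eq)
    have "\<bar>T p\<bar> = (\<Prod>k\<in>UNIV. \<bar>?A $ k $ p k\<bar>)"
      by (simp add: T_def abs_mult abs_prod sign_def)
    also have "\<dots> = \<bar>?A $ i $ p i\<bar> * (\<bar>?A $ j $ p j\<bar> * (\<Prod>k\<in>UNIV - {i} - {j}. \<bar>?A $ k $ p k\<bar>))"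
      using j(2) by (simp add: prod.remove[of _ i] prod.remove[of _ j])
    also have "\<dots> \<le> sqrt F * (sqrt F * (\<Prod>k\<in>UNIV - {i} - {j}. 2))"
    proof (intro mult_mono prod_mono conjI)
      show "\<bar>?A $ i $ p i\<bar> \<le> sqrt F" using i abs_entry by (simp add: mat_def)
      show "\<bar>?A $ j $ p j\<bar> \<le> sqrt F" using j abs_entry by (simp add: mat_def)
      show "\<bar>?A $ k $ p k\<bar> \<le> 2" for k
        using small[of k "p k"] by (auto simp: mat_def abs_le_iff)
    qed (auto simp: F0 intro!: prod_nonneg mult_nonneg_nonneg)
    also have "\<dots> = F * 2 ^ card (UNIV - {i} - {j})" using F0 by simp
    also have "\<dots> \<le> F * 2 ^ CARD('n)"
      using F0 by (intro mult_left_mono power_increasing card_mono) auto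
    finally show ?thesis by (simp add: mult.commute)
  qed
  have "det ?A = T id + (\<Sum>p\<in>P - {id}. T p)"
    using sum.remove[OF finP idP, of T] by (simp add: det_def T_def P_def)
  moreover have "(\<Sum>p\<in>P - {id}. T p) \<ge> (\<Sum>p\<in>P - {id}. - (2 ^ CARD('n) * F))"
    by (rule sum_mono) (rule off)
  moreover have "(\<Sum>p\<in>P - {id}. - (2 ^ CARD('n) * F)) \<ge> - (fact CARD('n) * 2 ^ CARD('n) * F)"
  proof -
    have "card P = fact CARD('n)" unfolding P_def by (rule card_permutations) auto
    then have "real (card (P - {id})) \<le> fact CARD('n)"
      using card_Diff1_le[of P id] by (metis of_nat_fact of_nat_mono)
    then have "real (card (P - {id})) * (2 ^ CARD('n) * F) \<le> fact CARD('n) * (2 ^ CARD('n) * F)"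
      using F0 by (intro mult_right_mono) auto
    then show ?thesis by (simp add: mult_ac)
  qed
  moreover have "T id \<ge> 1 - 2 * F"
  proof -
    have "T id = (\<Prod>i\<in>UNIV. 1 + H $ i $ i)" by (simp add: T_def sign_id mat_def)
    moreover have "\<dots> \<ge> 1 + (\<Sum>i\<in>UNIV. H $ i $ i) - 2 * (\<Sum>i\<in>UNIV. (H $ i $ i)\<^sup>2)"
      by (rule prod_one_plus_ge[OF small]) simp
    moreover have "(\<Sum>i\<in>UNIV. (H $ i $ i)\<^sup>2) \<le> F"
      unfolding F_def
      by (intro sum_mono member_le_sum[of _ UNIV "\<lambda>j. (H $ _ $ j)\<^sup>2"]) auto
    ultimately show ?thesis using tr by (simp add: trace_def)
  qed
  ultimately show ?thesis unfolding distrib_right left_diff_distrib by linarith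
qed

section \<open>Perturbing the quadratic form at a deep hole\<close>

text \<open>Carries a lower bound of at most 1 from a determinant over to its root.\<close>

lemma min_one_le_root:
  fixes x :: real
  assumes "0 \<le> x" "0 < m"
  shows "min 1 x \<le> root m x"
proof (cases "x \<le> 1")
  case True
  then show ?thesis using real_root_increasing[of 1 m x] assms by auto
next
  case False
  then show ?thesis using assms by auto
qed

lemma qform_diff:
  assumes "transpose A = A"
  shows "qform A (x - y) = qform A x - 2 * ((A *v x) \<bullet> y) + qform A y"
proof -
  have "x \<bullet> (A *v y) = (A *v x) \<bullet> y" "y \<bullet> (A *v x) = (A *v x) \<bullet> y"
    using symmetric_inner_swap[OF assms, of x y] by (simp_all only: inner_commute)
  then show ?thesis
    by (simp add: qform_def matrix_vector_mult_diff_distrib inner_diff_left inner_diff_right)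
qed

lemma abs_qform_le:
  assumes "\<And>i j. \<bar>H $ i $ j\<bar> \<le> b"
  shows "\<bar>qform H (y::real^'n)\<bar> \<le> real CARD('n) ^ 2 * b * (norm y)\<^sup>2"
proof -
  have "\<bar>qform H y\<bar> \<le> (\<Sum>i\<in>UNIV. \<Sum>j\<in>UNIV. \<bar>H $ i $ j * (y $ i * y $ j)\<bar>)"
    unfolding qform_eq_sum by (rule order_trans[OF sum_abs sum_mono[OF sum_abs]])
  also have "\<dots> \<le> (\<Sum>i\<in>(UNIV::'n set). \<Sum>j\<in>(UNIV::'n set). b * (norm y * norm y))"
    unfolding abs_mult
    by (intro sum_mono mult_mono assms component_le_norm_cart)
      (use assms in \<open>auto intro: order_trans[OF abs_ge_zero]\<close>)
  also have "\<dots> = real CARD('n) ^ 2 * b * (norm y)\<^sup>2" by (simp add: power2_eq_square)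
  finally show ?thesis .
qed

context sphere_design
begin

text \<open>The weights \<open>1 + d/2 (\<eta> \<bullet> y) - K H[y]\<close> are positive near the identity. The moments of the
  design give the weighted mean \<open>1 - C \<parallel>H\<parallel>\<^sup>2\<close> of \<open>(1 + H)[\<eta> - y]\<close>: the linear term
  cancels the contribution of \<open>\<eta>\<close>, and the quadratic one beats the second order term of
  the determinant.\<close>

lemma exists_near_vertex:
  "\<exists>\<delta>>0. \<forall>H \<eta>. transpose H = H \<longrightarrow> trace H = 0 \<longrightarrow> det (mat 1 + H) > 0 \<longrightarrow>
     (\<forall>i j. \<bar>H $ i $ j\<bar> \<le> \<delta>) \<longrightarrow> norm \<eta> \<le> \<delta> \<longrightarrow>
     (\<exists>y\<in>Y. qform (mat 1 + H) (\<eta> - y) \<le> root CARD('n) (det (mat 1 + H)))"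
proof -
  define d where "d = real CARD('n)"
  define C :: real where "C = 2 + fact CARD('n) * 2 ^ CARD('n)"
  \<comment> \<open>Chosen to cancel the factor \<open>2 / (d * (d + 2))\<close> of the fourth
    moment, so that the quadratic weight contributes exactly \<open>- N * (C * F)\<close>.\<close>
  define K where "K = C * (d * (d + 2)) / 2"
  \<comment> \<open>Cancels the factor \<open>1 / d\<close> of the second moment: the cross term
    becomes \<open>- N * (\<eta> \<bullet> u)\<close>, which is \<open>- N * a\<close>.\<close>
  define e where "e = d / 2"
  \<comment> \<open>The identity \<open>\<delta>_eq\<close> bounds every weight below by
    \<open>1 - d * \<delta> / 2 - d^2 * K * \<delta> = 1/2 + \<delta>\<close>, and also forces
    \<open>\<delta> \<le> 1/2\<close> as the determinant bound requires.\<close>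
  define \<delta> where "\<delta> = 1 / (d + 2 * (d\<^sup>2 * K) + 2)"
  have d: "d > 0" by (simp add: d_def)
  have C: "C > 0" by (simp add: C_def add_pos_pos)
  have K: "K > 0" using C d by (simp add: K_def)
  have den: "d + 2 * (d\<^sup>2 * K) + 2 > 0" using d K by (simp add: add_pos_pos)
  have \<delta>: "\<delta> > 0" unfolding \<delta>_def using den by simp
  have \<delta>_eq: "d * \<delta> + 2 * (d\<^sup>2 * K * \<delta>) + 2 * \<delta> = 1"
  proof -
    have "(d + 2 * (d\<^sup>2 * K) + 2) * \<delta> = 1" unfolding \<delta>_def using den by simp
    then show ?thesis by (simp add: algebra_simps)
  qed
  have "0 \<le> d * \<delta>" "0 \<le> d\<^sup>2 * K * \<delta>" using d K \<delta> by auto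
  then have \<delta>_half: "\<delta> \<le> 1/2" using \<delta>_eq by linarith
  have "\<exists>y\<in>Y. qform (mat 1 + H) (\<eta> - y) \<le> root CARD('n) (det (mat 1 + H))"
    if sym: "transpose H = H" and tr: "trace H = 0" and det_pos: "det (mat 1 + H) > 0"
      and H: "\<And>i j. \<bar>H $ i $ j\<bar> \<le> \<delta>" and \<eta>: "norm \<eta> \<le> \<delta>" for H \<eta>
  proof (rule ccontr)
    let ?A = "mat 1 + H"
    define \<rho> where "\<rho> = root CARD('n) (det ?A)"
    define F where "F = (\<Sum>i\<in>UNIV. \<Sum>j\<in>UNIV. (H $ i $ j)\<^sup>2)"
    define w where "w y = 1 + e * (\<eta> \<bullet> y) - K * qform H y" for y
    define u where "u = ?A *v \<eta>"
    define a where "a = qform ?A \<eta>"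
    assume "\<not> ?thesis"
    then have gt: "qform ?A (\<eta> - y) > \<rho>" if "y \<in> Y" for y
      using that unfolding \<rho>_def by force
    have "1 - C * F \<le> det ?A"
      unfolding C_def F_def by (rule det_one_plus_ge[OF order_trans[OF H \<delta>_half] tr])
    moreover have "F \<ge> 0" unfolding F_def by (intro sum_nonneg) auto
    ultimately have \<rho>: "1 - C * F \<le> \<rho>"
      using min_one_le_root[of "det ?A" "CARD('n)"] det_pos C
      unfolding \<rho>_def by (smt (verit) mult_nonneg_nonneg zero_less_card_finite)
    have w_pos: "w y > 0" if y: "y \<in> Y" for y
    proof -
      have "\<bar>\<eta> \<bullet> y\<bar> \<le> norm \<eta> * norm y" by (rule Cauchy_Schwarz_ineq2)
      then have 1: "\<bar>\<eta> \<bullet> y\<bar> \<le> \<delta>" using unit[OF y] \<eta> by simp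
      have 2: "\<bar>qform H y\<bar> \<le> d\<^sup>2 * \<delta>"
        using abs_qform_le[OF H, of y] unit[OF y] by (simp add: d_def)
      have "e * (\<eta> \<bullet> y) \<ge> - (e * \<delta>)"
        using mult_left_mono[of "- \<delta>" "\<eta> \<bullet> y" e] 1 d by (auto simp: e_def)
      moreover have "e * \<delta> = d * \<delta> / 2" by (simp add: e_def)
      moreover have "K * qform H y \<le> K * (d\<^sup>2 * \<delta>)"
        using mult_left_mono[of "qform H y" "d\<^sup>2 * \<delta>" K] 2 K by auto
      moreover have "K * (d\<^sup>2 * \<delta>) = d\<^sup>2 * K * \<delta>" by simp
      ultimately show ?thesis unfolding w_def using \<delta>_eq \<delta> by linarith
    qed
    have symA: "transpose ?A = ?A"
      using sym by (simp add: transpose_def vec_eq_iff mat_def)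
    have expand: "qform ?A (\<eta> - y) = a - 2 * (u \<bullet> y) + 1 + qform H y" if "y \<in> Y" for y
    proof -
      have "qform ?A y = y \<bullet> y + qform H y"
        by (simp add: qform_def matrix_vector_mult_add_rdistrib inner_add_right)
      then show ?thesis
        using unit[OF that] by (simp add: qform_diff[OF symA] a_def u_def norm_eq_1)
    qed
    \<comment> \<open>If every vertex exceeded \<open>\<rho>\<close>, this weighted sum would be
      positive; the moments evaluate it to \<open>N * (1 - C * F - \<rho>)\<close>, which is at most
      0.\<close>
    have "0 < (\<Sum>y\<in>Y. w y * (qform ?A (\<eta> - y) - \<rho>))"
      using w_pos gt by (intro sum_pos fin ne) auto
    also have "\<dots> = (\<Sum>y\<in>Y. (a + 1 - \<rho>) - 2 * (u \<bullet> y) + qform H y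
        + e * (a + 1 - \<rho>) * (\<eta> \<bullet> y) - 2 * e * ((\<eta> \<bullet> y) * (u \<bullet> y)) + e * ((\<eta> \<bullet> y) * qform H y)
        - K * (a + 1 - \<rho>) * qform H y + 2 * K * ((u \<bullet> y) * qform H y) - K * (qform H y)\<^sup>2)"
      by (intro sum.cong refl, simp only: expand w_def power2_eq_square) (simp add: algebra_simps)
    also have "\<dots> = (\<Sum>y\<in>Y. a + 1 - \<rho>) - 2 * (\<Sum>y\<in>Y. u \<bullet> y) + (\<Sum>y\<in>Y. qform H y)
        + e * (a + 1 - \<rho>) * (\<Sum>y\<in>Y. \<eta> \<bullet> y) - 2 * e * (\<Sum>y\<in>Y. (\<eta> \<bullet> y) * (u \<bullet> y))
        + e * (\<Sum>y\<in>Y. (\<eta> \<bullet> y) * qform H y) - K * (a + 1 - \<rho>) * (\<Sum>y\<in>Y. qform H y)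
        + 2 * K * (\<Sum>y\<in>Y. (u \<bullet> y) * qform H y) - K * (\<Sum>y\<in>Y. (qform H y)\<^sup>2)"
      unfolding sum_distrib_left sum.distrib sum_subtractf ..
    also have "\<dots> = N * (a + 1 - \<rho>) - N * (\<eta> \<bullet> u) - K * (N / (d * (d + 2)) * (2 * F))"
      unfolding sum_inner sum_inner_inner sum_qform sum_inner_qform sum_qform_qform[OF sym] tr
      using d by (simp add: d_def[symmetric] F_def e_def)
    also have "\<eta> \<bullet> u = a" by (simp add: u_def a_def qform_def)
    also have "K * (N / (d * (d + 2)) * (2 * F)) = N * (C * F)"
    proof -
      have "C * D / 2 * (N / D * (2 * F)) = N * (C * F)" if "D \<noteq> 0" for D
        using that by (simp add: field_simps)
      from this[of "d * (d + 2)"] show ?thesis using d unfolding K_def by simp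
    qed
    also have "N * (a + 1 - \<rho>) - N * a - N * (C * F) = N * (1 - C * F - \<rho>)"
      by (simp add: algebra_simps)
    finally show False using \<rho> N_pos by (simp add: zero_less_mult_iff)
  qed
  then show ?thesis using \<delta> by blast
qed

end

section \<open>Transport of the design from the ellipsoid to the unit sphere\<close>

lemma matrix_inv:
  fixes A :: "real^'n^'n"
  assumes "invertible A"
  shows "A ** matrix_inv A = mat 1" "matrix_inv A ** A = mat 1"
proof -
  have "A ** matrix_inv A = mat 1 \<and> matrix_inv A ** A = mat 1"
    unfolding matrix_inv_def by (rule someI_ex) (use assms in \<open>simp add: invertible_def\<close>)
  then show "A ** matrix_inv A = mat 1" "matrix_inv A ** A = mat 1" by blast+
qed

lemma det_scaleR:
  fixes A :: "real^'n^'n"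
  shows "det (k *\<^sub>R A) = k ^ CARD('n) * det A"
  by (simp add: det_def prod.distrib sum_distrib_left mult_ac)

lemma qform_matrix_vector:
  "qform A (M *v x) = qform (transpose M ** A ** M) x"
proof -
  have "x \<bullet> (transpose M *v z) = (M *v x) \<bullet> z" for z
    using dot_lmul_matrix[of x "transpose M" z] transpose_matrix_vector[of "transpose M" x] by simp
  then show ?thesis by (simp add: qform_def matrix_vector_mul_assoc[symmetric])
qed

lemma qform_scaleR: "qform A (k *\<^sub>R x) = k\<^sup>2 * qform A x"
  by (simp add: qform_def matrix_vector_mult_scaleR power2_eq_square)

lemma qform_eq_norm_sqrt:
  assumes "pqf Q"
  shows "qform Q x = (norm (pd_sqrt Q *v x))\<^sup>2"
proof -
  have "transpose (pd_sqrt Q) = pd_sqrt Q" using pd_sqrt(1)[OF assms] by (simp add: pqf_def)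
  then have "qform Q x = qform (mat 1) (pd_sqrt Q *v x)"
    using pd_sqrt(2)[OF assms] by (simp add: qform_matrix_vector)
  then show ?thesis by (simp add: qform_def dot_square_norm)
qed

lemma integral_sphere_measure_orthogonal:
  fixes f :: "real^'n \<Rightarrow> real^'n"
  assumes "continuous_on UNIV (p :: real^'n \<Rightarrow> real)" "orthogonal_transformation f"
  shows "(\<integral>y. p (f y) \<partial>sphere_measure) = (\<integral>y. p y \<partial>sphere_measure)"
proof -
  have "continuous_on UNIV f"
    using orthogonal_transformation_linear[OF assms(2)] by (simp add: linear_continuous_on linear_conv_bounded_linear)
  then have "f \<in> sphere_measure \<rightarrow>\<^sub>M borel"
    using borel_measurable_continuous_onI[of f] by (simp add: measurable_cong_sets[OF sets_sphere_measure refl])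
  moreover have "p \<in> borel_measurable borel" using assms(1) by (rule borel_measurable_continuous_onI)
  ultimately show ?thesis
    using integral_distr[of f sphere_measure borel p] sphere_measure_rotation_invariant[OF assms(2)] by simp
qed

text \<open>The map undoes the parametrisation in \<open>qsphere_measure\<close>, so the design
  integrals become integrals over \<open>sphere_measure\<close>, whose rotation invariance yields
  \<open>inv\<close>.\<close>

lemma sphere_design_image:
  fixes Q :: "real^'n^'n"
  assumes Q: "pqf Q" and X: "finite X" "X \<subseteq> qsphere Q c r" and r: "r > 0"
    and int: "\<And>p. polyfun_le 4 p \<Longrightarrow>
      (1 / real (card X)) * (\<Sum>x\<in>X. p x) = (\<integral>x. p x \<partial>qsphere_measure Q c r)"
  shows "sphere_design ((\<lambda>x. (1 / r) *\<^sub>R (pd_sqrt Q *v (x - c))) ` X)"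
proof
  define R where "R = pd_sqrt Q"
  let ?S = "matrix_inv R"
  let ?g = "\<lambda>x. (1 / r) *\<^sub>R (R *v (x - c))"
  have R: "R ** ?S = mat 1" "?S ** R = mat 1"
    using matrix_inv[OF pqf_invertible[OF pd_sqrt(1)[OF Q]]] by (auto simp: R_def)
  have inj: "inj_on ?g X"
  proof (rule inj_onI)
    fix x y assume "?g x = ?g y"
    then have "?S *v (R *v (x - c)) = ?S *v (R *v (y - c))" using r by simp
    then show "x = y" using R(2) by (simp add: matrix_vector_mul_assoc)
  qed
  interpret prob_space "sphere_measure :: (real^'n) measure" by (rule prob_space_sphere_measure)
  have "continuous_on UNIV (\<lambda>y. c + r *\<^sub>R (?S *v y))" by (intro continuous_intros)
  then have meas: "(\<lambda>y. c + r *\<^sub>R (?S *v y)) \<in> sphere_measure \<rightarrow>\<^sub>M borel"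
    using borel_measurable_continuous_onI[of "\<lambda>y. c + r *\<^sub>R (?S *v y)"]
    by (simp add: measurable_cong_sets[OF sets_sphere_measure refl])
  have int_eq: "(\<integral>x. p x \<partial>qsphere_measure Q c r) = (\<integral>y. p (c + r *\<^sub>R (?S *v y)) \<partial>sphere_measure)"
    if "continuous_on UNIV p" for p :: "real^'n \<Rightarrow> real"
    unfolding qsphere_measure_def R_def[symmetric]
    by (rule integral_distr[OF meas]) (rule borel_measurable_continuous_onI[OF that])
  \<comment> \<open>The constant polynomial excludes an empty \<open>X\<close>: there division by
    zero would make the left side 0.\<close>
  have "(1 / real (card X)) * (\<Sum>x\<in>X. 1) = (1::real)"
    using int[OF polyfun_le_const[of _ 1]] int_eq[of "\<lambda>_. 1"] by (simp add: prob_space)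
  then have "card X \<noteq> 0" by (auto split: if_splits)
  then show "?g ` X \<noteq> {}" by auto
  show "finite (?g ` X)" using X by simp
  show "norm y = 1" if "y \<in> ?g ` X" for y
    using that X(2) r by (auto simp: qsphere_def qform_eq_norm_sqrt[OF Q] R_def)
  have g: "polyfun_le 1 (\<lambda>x. ?g x $ i)" for i
  proof -
    have "linear (\<lambda>x. (1 / r) * (R *v x) $ i)"
      by (auto simp: linear_iff matrix_vector_right_distrib matrix_vector_mult_scaleR algebra_simps add_divide_distrib)
    then have "polyfun_le 1 (\<lambda>x. (1 / r) * (R *v x) $ i - (1 / r) * (R *v c) $ i)"
      by (intro polyfun_le_diff polyfun_le_linear polyfun_le_const)
    then show ?thesis by (simp add: matrix_vector_mult_diff_distrib algebra_simps)
  qed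
  have mean: "(\<Sum>y\<in>?g ` X. p y) = real (card X) * (\<integral>y. p y \<partial>sphere_measure)"
    if p: "polyfun_le 4 p" for p
  proof -
    have pg: "polyfun_le 4 (\<lambda>x. p (?g x))" by (rule polyfun_le_compose[OF p g])
    have "?g (c + r *\<^sub>R (?S *v y)) = y" for y
      using r R(1) by (simp add: matrix_vector_mult_scaleR matrix_vector_mul_assoc)
    then have "(\<integral>x. p (?g x) \<partial>qsphere_measure Q c r) = (\<integral>y. p y \<partial>sphere_measure)"
      using int_eq[OF continuous_on_polyfun[OF pg]] by simp
    moreover have "(\<Sum>y\<in>?g ` X. p y) = (\<Sum>x\<in>X. p (?g x))"
      using sum.reindex[OF inj] by simp
    ultimately show ?thesis using int[OF pg] \<open>card X \<noteq> 0\<close> by (simp add: field_simps)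
  qed
  show "(\<Sum>y\<in>?g ` X. p (f y)) = (\<Sum>y\<in>?g ` X. p y)"
    if p: "polyfun_le 4 p" and f: "orthogonal_transformation f" for p f
  proof -
    have "polyfun_le 1 (\<lambda>x. f x $ i)" for i
      using orthogonal_transformation_linear[OF f] by (intro polyfun_le_linear) (auto simp: linear_iff)
    then have "polyfun_le 4 (\<lambda>x. p (f x))" by (rule polyfun_le_compose[OF p])
    then show ?thesis
      using mean p integral_sphere_measure_orthogonal[OF continuous_on_polyfun[OF p] f] by simp
  qed
qed

text \<open>A design lies on only one sphere. Expanding the norm gives
  \<open>k + 2 * r * (b \<bullet> y) = 0\<close> on \<open>Y\<close>; summation forces
  \<open>k = 0\<close>, so \<open>b\<close> is orthogonal to \<open>Y\<close>, and the second moment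
  forces \<open>b = 0\<close>.\<close>

lemma (in sphere_design) sphere_center_unique:
  assumes "\<And>y. y \<in> Y \<Longrightarrow> (norm (b + r *\<^sub>R y))\<^sup>2 = m" and "r > 0"
  shows "b = 0" "r\<^sup>2 = m"
proof -
  define k where "k = b \<bullet> b + r\<^sup>2 - m"
  have k: "k + 2 * r * (b \<bullet> y) = 0" if "y \<in> Y" for y
  proof -
    have "y \<bullet> y = 1" using unit[OF that] by (simp add: norm_eq_1)
    moreover have "m = (b + r *\<^sub>R y) \<bullet> (b + r *\<^sub>R y)"
      using assms(1)[OF that] by (simp add: power2_norm_eq_inner)
    ultimately show ?thesis
      by (simp add: k_def inner_add_left inner_add_right inner_commute[of y b] power2_eq_square algebra_simps)
  qed
  then have "0 = (\<Sum>y\<in>Y. k + 2 * r * (b \<bullet> y))" by simp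
  also have "\<dots> = N * k" by (simp add: sum.distrib sum_distrib_left[symmetric] sum_inner)
  finally have k0: "k = 0" using N_pos by simp
  then have "b \<bullet> y = 0" if "y \<in> Y" for y using k[OF that] assms(2) by simp
  then have "N / real CARD('n) * (b \<bullet> b) = 0"
    using sum_inner_inner[of b b] by simp
  then show b: "b = 0" using N_pos by simp
  show "r\<^sup>2 = m" using k0 b by (simp add: k_def)
qed

section \<open>Continuity, and the bound near a deep hole\<close>

lemma tendsto_matrix_mult:
  fixes A :: "real^'n^'m" and B :: "real^'k^'n"
  assumes "(f \<longlongrightarrow> A) F" "(g \<longlongrightarrow> B) F"
  shows "((\<lambda>z. f z ** g z) \<longlongrightarrow> A ** B) F"
proof (intro vec_tendstoI)
  show "((\<lambda>z. (f z ** g z) $ i $ j) \<longlongrightarrow> (A ** B) $ i $ j) F" for i j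
    unfolding matrix_matrix_mult_def vec_lambda_beta
    by (intro tendsto_sum tendsto_mult tendsto_vec_nth assms)
qed

lemma tendsto_det:
  fixes A :: "real^'n^'n"
  assumes "(f \<longlongrightarrow> A) F"
  shows "((\<lambda>z. det (f z)) \<longlongrightarrow> det A) F"
  unfolding det_def by (intro tendsto_sum tendsto_mult tendsto_prod tendsto_const tendsto_vec_nth assms)

lemma tendsto_qform:
  fixes A :: "real^'n^'n"
  assumes "(f \<longlongrightarrow> A) F" "(g \<longlongrightarrow> x) F"
  shows "((\<lambda>z. qform (f z) (g z)) \<longlongrightarrow> qform A x) F"
  unfolding qform_eq_sum by (intro tendsto_sum tendsto_mult tendsto_vec_nth assms)

text \<open>Form and point vary together, since a deep hole moves with the form. The coordinates
  \<open>\<eta> = R (x - c) / r\<close> reduce the claim to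
  \<open>exists_near_vertex\<close>.\<close>

lemma deep_hole_nearby:
  fixes Q :: "real^'n^'n"
  assumes Q: "pqf Q" and des: "carries_spherical_design 4 Q (Min_at c Q)"
  shows "\<forall>\<^sub>F z in nhds (Q, c). pqf (fst z) \<longrightarrow>
    (\<exists>v\<in>int_lattice. qform (fst z) (snd z - v) \<le>
      inhom_min Q * (root CARD('n) (det (fst z)) / root CARD('n) (det Q)))"
proof -
  define d where "d = real CARD('n)"
  define R where "R = pd_sqrt Q"
  define S where "S = matrix_inv R"
  let ?X = "Min_at c Q"
  obtain c' r where r: "r > 0" and X: "finite ?X" "?X \<subseteq> qsphere Q c' r"
    and int: "\<And>p. polyfun_le 4 p \<Longrightarrow>
      (1 / real (card ?X)) * (\<Sum>x\<in>?X. p x) = (\<integral>x. p x \<partial>qsphere_measure Q c' r)"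
    using des unfolding carries_spherical_design_def by blast
  define Y where "Y = (\<lambda>x. (1 / r) *\<^sub>R (R *v (x - c'))) ` ?X"
  interpret sphere_design Y
    unfolding Y_def R_def by (rule sphere_design_image[OF Q X r int])
  have d: "d > 0" by (simp add: d_def)
  have RS: "R ** S = mat 1" "S ** R = mat 1"
    using matrix_inv[OF pqf_invertible[OF pd_sqrt(1)[OF Q]]] by (auto simp: R_def S_def)
  have RR: "R ** R = Q" and symR: "transpose R = R"
    using pd_sqrt[OF Q] by (auto simp: R_def pqf_def)
  have "transpose S ** R = mat 1" using arg_cong[OF RS(1), of transpose] symR by (simp add: matrix_transpose_mul)
  then have "transpose S ** R ** S = S" by simp
  then have symS: "transpose S = S" by (simp add: matrix_mul_assoc[symmetric] RS)
  \<comment> \<open>A design comes with some centre and radius; they are shown to be the hole and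
    the root of the inhomogeneous minimum.\<close>
  have center: "c' = c" "r\<^sup>2 = inhom_min Q"
  proof -
    have "(norm (R *v (c' - c) + r *\<^sub>R y))\<^sup>2 = inhom_min Q" if yY: "y \<in> Y" for y
    proof -
      obtain x where x: "x \<in> ?X" "y = (1 / r) *\<^sub>R (R *v (x - c'))" using yY by (auto simp: Y_def)
      have "R *v (c' - c) + r *\<^sub>R y = R *v (x - c)"
        using r x(2) by (simp add: matrix_vector_mult_diff_distrib)
      then show ?thesis using x(1) by (simp add: Min_at_def qform_eq_norm_sqrt[OF Q] R_def)
    qed
    from sphere_center_unique[OF this r] have "R *v (c' - c) = 0" and r2: "r\<^sup>2 = inhom_min Q" by auto
    then have "S *v (R *v (c' - c)) = 0" by simp
    then show "c' = c" by (simp add: matrix_vector_mul_assoc RS)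
    show "r\<^sup>2 = inhom_min Q" by (rule r2)
  qed
  obtain \<delta> where \<delta>: "\<delta> > 0" and near: "\<And>H \<eta>. transpose H = H \<Longrightarrow> trace H = 0 \<Longrightarrow>
      det (mat 1 + H) > 0 \<Longrightarrow> (\<forall>i j. \<bar>H $ i $ j\<bar> \<le> \<delta>) \<Longrightarrow> norm \<eta> \<le> \<delta> \<Longrightarrow>
      (\<exists>y\<in>Y. qform (mat 1 + H) (\<eta> - y) \<le> root CARD('n) (det (mat 1 + H)))"
    using exists_near_vertex by blast
  \<comment> \<open>\<open>A P\<close> is \<open>P\<close> in coordinates that make \<open>Q\<close>
    the identity. Dividing by the mean \<open>s P\<close> of its diagonal leaves the identity plus a
    traceless \<open>H P\<close>.\<close>
  define A where "A P = S ** P ** S" for P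
  define s where "s P = trace (A P) / d" for P
  define H where "H P = (1 / s P) *\<^sub>R A P - mat 1" for P
  have AQ: "A Q = mat 1"
    by (simp add: A_def RR[symmetric] matrix_mul_assoc RS)
  have sQ: "s Q = 1" by (simp add: s_def AQ trace_I d_def)
  have HQ: "H Q = 0" by (simp add: H_def AQ sQ)
  have lim: "((\<lambda>z. fst z) \<longlongrightarrow> Q) (nhds (Q, c))" "((\<lambda>z. snd z) \<longlongrightarrow> c) (nhds (Q, c))"
    using tendsto_fst[OF filterlim_ident[of "nhds (Q, c)"]] tendsto_snd[OF filterlim_ident[of "nhds (Q, c)"]] by auto
  have limA: "((\<lambda>z. A (fst z)) \<longlongrightarrow> A Q) (nhds (Q, c))"
    unfolding A_def by (intro tendsto_matrix_mult lim tendsto_const)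
  have lims: "((\<lambda>z. s (fst z)) \<longlongrightarrow> s Q) (nhds (Q, c))"
    unfolding s_def trace_def by (intro tendsto_intros limA) (use d in simp)
  have "((\<lambda>z. H (fst z)) \<longlongrightarrow> H Q) (nhds (Q, c))"
    unfolding H_def by (intro tendsto_intros limA lims) (simp add: sQ)
  then have "((\<lambda>z. \<bar>H (fst z) $ i $ j\<bar>) \<longlongrightarrow> \<bar>H Q $ i $ j\<bar>) (nhds (Q, c))" for i j
    by (intro tendsto_intros)
  then have "\<forall>\<^sub>F z in nhds (Q, c). \<bar>H (fst z) $ i $ j\<bar> < \<delta>" for i j
    by (rule order_tendstoD(2)) (simp add: HQ \<delta>)
  then have evH: "\<forall>\<^sub>F z in nhds (Q, c). \<forall>i j. \<bar>H (fst z) $ i $ j\<bar> < \<delta>"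
    by (intro eventually_all_finite)
  have "((\<lambda>z. norm ((1 / r) *\<^sub>R (R *v (snd z - c)))) \<longlongrightarrow> norm ((1 / r) *\<^sub>R (R *v (c - c)))) (nhds (Q, c))"
    by (intro tendsto_intros lim bounded_linear.tendsto[OF matrix_vector_mul_bounded_linear])
  then have ev\<eta>: "\<forall>\<^sub>F z in nhds (Q, c). norm ((1 / r) *\<^sub>R (R *v (snd z - c))) < \<delta>"
    by (rule order_tendstoD(2)) (simp add: \<delta>)
  have evs: "\<forall>\<^sub>F z in nhds (Q, c). s (fst z) > 0"
    using lims by (rule order_tendstoD(1)) (simp add: sQ)
  have "\<exists>v\<in>int_lattice. qform P (x - v) \<le> inhom_min Q * (root CARD('n) (det P) / root CARD('n) (det Q))"
    if P: "pqf P" and HP: "\<forall>i j. \<bar>H P $ i $ j\<bar> < \<delta>"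
      and x: "norm ((1 / r) *\<^sub>R (R *v (x - c))) < \<delta>" and sP: "s P > 0" for P x
  proof -
    have "transpose P = P" using P by (simp add: pqf_def)
    then have "transpose (A P) = A P" by (simp add: A_def matrix_transpose_mul symS matrix_mul_assoc)
    then have symH: "transpose (H P) = H P" by (simp add: H_def transpose_def vec_eq_iff mat_def)
    have "trace (A P) = s P * d" using d by (simp add: s_def)
    then have trH: "trace (H P) = 0"
      using sP by (simp add: H_def trace_sub trace_I d_def) (simp add: trace_def sum_divide_distrib[symmetric] d_def)
    have one: "mat 1 + H P = (1 / s P) *\<^sub>R A P" by (simp add: H_def)
    have detS: "det S * det S * det Q = 1"
    proof -
      have "det S * det R = 1" using arg_cong[OF RS(2), of det] by (simp add: det_mul)
      moreover have "det Q = det R * det R" using RR by (metis det_mul)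
      moreover have "det S * det S * (det R * det R) = (det S * det R) * (det S * det R)" by simp
      ultimately show ?thesis by simp
    qed
    have detA: "det (A P) = det P / det Q"
      using detS pqf_det_pos[OF Q] by (simp add: A_def det_mul field_simps)
    have detH: "det (mat 1 + H P) = (1 / s P) ^ CARD('n) * (det P / det Q)"
      by (simp add: one det_scaleR detA)
    have "det (mat 1 + H P) > 0"
      using detH sP pqf_det_pos[OF Q] pqf_det_pos[OF P] by simp
    then obtain y where y: "y \<in> Y" "qform (mat 1 + H P) ((1 / r) *\<^sub>R (R *v (x - c)) - y)
        \<le> root CARD('n) (det (mat 1 + H P))"
      using near[OF symH trH] HP x by (meson less_imp_le)
    obtain v where v: "v \<in> ?X" "y = (1 / r) *\<^sub>R (R *v (v - c))"
      using y(1) by (auto simp: Y_def center)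
    have "(1 / r) *\<^sub>R (R *v (x - c)) - y = (1 / r) *\<^sub>R (R *v (x - v))"
      unfolding v(2) by (simp add: matrix_vector_mult_diff_distrib algebra_simps)
    moreover have "R ** A P ** R = P"
      by (simp add: A_def matrix_mul_assoc RS) (simp add: matrix_mul_assoc[symmetric] RS)
    then have "qform (A P) (R *v (x - v)) = qform P (x - v)"
      by (simp add: qform_matrix_vector symR)
    moreover have "qform (k *\<^sub>R M) z = k * qform M z" for k M and z :: "real^'n"
      by (simp add: qform_def scaleR_matrix_vector_assoc[symmetric])
    ultimately have "qform (mat 1 + H P) ((1 / r) *\<^sub>R (R *v (x - c)) - y) = qform P (x - v) / (s P * r\<^sup>2)"
      by (simp add: one qform_scaleR power_divide)
    \<comment> \<open>Both sides of the vertex bound carry a factor \<open>1 / s P\<close>;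
      multiplying by \<open>s P * r^2\<close> removes the normalisation.\<close>
    moreover have "root CARD('n) (det (mat 1 + H P)) = (1 / s P) * (root CARD('n) (det P) / root CARD('n) (det Q))"
      using sP by (simp add: detH real_root_mult real_root_divide real_root_power_cancel real_root_power)
    ultimately have "qform P (x - v) / (s P * r\<^sup>2) \<le> (1 / s P) * (root CARD('n) (det P) / root CARD('n) (det Q))"
      using y(2) by simp
    then have "qform P (x - v) \<le> (1 / s P) * (root CARD('n) (det P) / root CARD('n) (det Q)) * (s P * r\<^sup>2)"
      using sP r by (subst (asm) pos_divide_le_eq) auto
    also have "\<dots> = r\<^sup>2 * (root CARD('n) (det P) / root CARD('n) (det Q))" using sP by simp
    finally show ?thesis using v(1) center(2) by (auto simp: Min_at_def)
  qed
  then show ?thesis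
    using eventually_conj[OF evH eventually_conj[OF ev\<eta> evs]] by (auto elim!: eventually_mono)
qed

section \<open>From deep holes to the covering constant\<close>

lemma dist_lattice_le:
  assumes "pqf Q" "v \<in> int_lattice"
  shows "dist_lattice Q x \<le> qform Q (x - v)"
proof -
  have "0 \<le> qform Q y" for y
    using assms(1) by (cases "y = 0") (auto simp: pqf_def qform_def less_imp_le)
  then have "bdd_below ((\<lambda>v. qform Q (x - v)) ` int_lattice)" by (intro bdd_belowI2[of _ 0])
  then show ?thesis unfolding dist_lattice_def by (rule cINF_lower) (rule assms(2))
qed

lemma zero_int_lattice: "0 \<in> int_lattice"
  by (simp add: int_lattice_def)

lemma int_lattice_add: "u \<in> int_lattice \<Longrightarrow> v \<in> int_lattice \<Longrightarrow> u + v \<in> int_lattice"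
  by (simp add: int_lattice_def)

text \<open>Taking floors lets the compact unit cube represent all points modulo the
  lattice.\<close>

lemma int_lattice_reduce:
  fixes x :: "real^'n"
  obtains u where "u \<in> int_lattice" "x - u \<in> cbox 0 1"
proof
  show "(\<chi> i. real_of_int \<lfloor>x $ i\<rfloor>) \<in> int_lattice" by (simp add: int_lattice_def)
  show "x - (\<chi> i. real_of_int \<lfloor>x $ i\<rfloor>) \<in> cbox 0 1"
    unfolding mem_box_cart by (auto simp: floor_correct) linarith
qed

text \<open>The supremum is a genuine upper bound because the values are bounded: after reduction to
  the unit cube, compactness bounds the form.\<close>

lemma dist_lattice_le_inhom_min:
  fixes Q :: "real^'n^'n"
  assumes Q: "pqf Q"
  shows "dist_lattice Q x \<le> inhom_min Q"
proof -
  have "continuous_on (cbox 0 1) (qform Q)" unfolding qform_def by (intro continuous_intros)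
  then have "bounded (qform Q ` cbox 0 1)" by (intro compact_imp_bounded compact_continuous_image) auto
  then obtain B where B: "\<And>y. y \<in> cbox 0 1 \<Longrightarrow> \<bar>qform Q y\<bar> \<le> B"
    unfolding bounded_iff by auto
  have "dist_lattice Q y \<le> B" for y
  proof -
    obtain u where "u \<in> int_lattice" "y - u \<in> cbox 0 1" by (rule int_lattice_reduce)
    then show ?thesis using dist_lattice_le[OF Q, of u y] B[of "y - u"] by auto
  qed
  then show ?thesis unfolding inhom_min_def by (intro cSUP_upper bdd_aboveI2) auto
qed

text \<open>Below the maximum, one lattice vector beats the bound strictly at \<open>(Q, c)\<close>,
  and both sides are continuous in form and point.\<close>

lemma shallow_point_nearby:
  fixes Q :: "real^'n^'n"
  assumes Q: "pqf Q" and c: "dist_lattice Q c < inhom_min Q"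
  shows "\<forall>\<^sub>F z in nhds (Q, c). \<exists>v\<in>int_lattice. qform (fst z) (snd z - v) \<le>
      inhom_min Q * (root CARD('n) (det (fst z)) / root CARD('n) (det Q))"
proof -
  obtain v where v: "v \<in> int_lattice" "qform Q (c - v) < inhom_min Q"
  proof (rule ccontr)
    assume "\<not> thesis"
    then have "inhom_min Q \<le> qform Q (c - v)" if "v \<in> int_lattice" for v
      using that \<open>\<And>v. v \<in> int_lattice \<Longrightarrow> qform Q (c - v) < inhom_min Q \<Longrightarrow> thesis\<close> by force
    then have "inhom_min Q \<le> dist_lattice Q c"
      unfolding dist_lattice_def using zero_int_lattice by (intro cINF_greatest) auto
    then show False using c by simp
  qed
  have root: "root CARD('n) (det Q) > 0" using pqf_det_pos[OF Q] by simp
  have lim: "((\<lambda>z. fst z) \<longlongrightarrow> Q) (nhds (Q, c))" "((\<lambda>z. snd z) \<longlongrightarrow> c) (nhds (Q, c))"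
    using tendsto_fst[OF filterlim_ident[of "nhds (Q, c)"]]
      tendsto_snd[OF filterlim_ident[of "nhds (Q, c)"]] by auto
  have "((\<lambda>z. inhom_min Q * (root CARD('n) (det (fst z)) / root CARD('n) (det Q)) - qform (fst z) (snd z - v))
     \<longlongrightarrow> inhom_min Q * (root CARD('n) (det Q) / root CARD('n) (det Q)) - qform Q (c - v)) (nhds (Q, c))"
    by (intro tendsto_intros tendsto_qform tendsto_det tendsto_real_root lim) (use root in simp)
  then have "\<forall>\<^sub>F z in nhds (Q, c). 0 < inhom_min Q * (root CARD('n) (det (fst z)) / root CARD('n) (det Q))
      - qform (fst z) (snd z - v)"
    by (rule order_tendstoD(1)) (use v(2) root in simp)
  then show ?thesis by (rule eventually_mono) (use v(1) in force)
qed

lemma eventually_ball_compact: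
  fixes K :: "'b::topological_space set"
  assumes K: "compact K" and P: "\<And>x. x \<in> K \<Longrightarrow> \<forall>\<^sub>F z in nhds (a, x). P (fst z) (snd z)"
  shows "\<forall>\<^sub>F y in nhds a. \<forall>x\<in>K. P y x"
proof -
  \<comment> \<open>The tube lemma requires an open set around
    \<open>{a} \<times> K\<close>.\<close>
  let ?W = "interior {z. P (fst z) (snd z)}"
  have "{a} \<times> K \<subseteq> ?W"
  proof clarify
    fix x assume "x \<in> K"
    from P[OF this] obtain S where "open S" "(a, x) \<in> S" "\<forall>z\<in>S. P (fst z) (snd z)"
      unfolding eventually_nhds by auto
    then show "(a, x) \<in> ?W" by (intro interiorI[of S]) auto
  qed
  from Elementary_Topology.tube_lemma[OF K open_interior this] obtain X where X: "a \<in> X" "open X" "X \<times> K \<subseteq> ?W"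
    by blast
  have "P y x" if "y \<in> X" "x \<in> K" for y x
  proof -
    have "(y, x) \<in> {z. P (fst z) (snd z)}" using X(3) that interior_subset by blast
    then show ?thesis by simp
  qed
  then show ?thesis unfolding eventually_nhds by (intro exI[of _ X] conjI ballI X(1,2))
qed

theorem theorem4p3:
  fixes Q :: "real^'n^'n"
  assumes "pqf Q" and "strongly_inhomogeneous_perfect Q"
  shows "inhomogeneous_extreme Q"
proof -
  \<comment> \<open>For positive definite \<open>P\<close>, \<open>inhom_min P \<le> M P\<close> is
    equivalent to \<open>gamma_i P \<le> gamma_i Q\<close>.\<close>
  define M where "M P = inhom_min Q * (root CARD('n) (det P) / root CARD('n) (det Q))" for P :: "real^'n^'n"
  have "\<forall>\<^sub>F z in nhds (Q, c). pqf (fst z) \<longrightarrow> (\<exists>v\<in>int_lattice. qform (fst z) (snd z - v) \<le> M (fst z))" for c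
  proof (cases "dist_lattice Q c = inhom_min Q")
    case True
    then show ?thesis
      using deep_hole_nearby[OF assms(1)] assms(2)
      unfolding strongly_inhomogeneous_perfect_def M_def by blast
  next
    case False
    then have "dist_lattice Q c < inhom_min Q"
      using dist_lattice_le_inhom_min[OF assms(1), of c] by simp
    from shallow_point_nearby[OF assms(1) this] show ?thesis
      unfolding M_def by (rule eventually_mono) blast
  qed
  then have "\<forall>\<^sub>F P in nhds Q. \<forall>c\<in>cbox 0 1. pqf P \<longrightarrow> (\<exists>v\<in>int_lattice. qform P (c - v) \<le> M P)"
    by (intro eventually_ball_compact compact_cbox)
  moreover have "gamma_i P \<le> gamma_i Q"
    if P: "pqf P" and near: "\<forall>c\<in>cbox 0 1. pqf P \<longrightarrow> (\<exists>v\<in>int_lattice. qform P (c - v) \<le> M P)"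
    for P
  proof -
    \<comment> \<open>Translating by a lattice vector extends the bound from the cube to every
      point.\<close>
    have "dist_lattice P x \<le> M P" for x
    proof -
      obtain u where u: "u \<in> int_lattice" "x - u \<in> cbox 0 1" by (rule int_lattice_reduce)
      then obtain v where v: "v \<in> int_lattice" "qform P (x - u - v) \<le> M P" using P near by blast
      show ?thesis
        using dist_lattice_le[OF P int_lattice_add[OF u(1) v(1)], of x] v(2) by (simp add: diff_diff_eq)
    qed
    then have "inhom_min P \<le> M P" unfolding inhom_min_def by (intro cSUP_least) auto
    moreover have "root CARD('n) (det P) > 0" using pqf_det_pos[OF P] by simp
    ultimately show ?thesis by (simp add: gamma_i_def M_def field_simps)
  qed
  ultimately show ?thesis
    unfolding inhomogeneous_extreme_def eventually_at_filter
    using assms(1) by (auto elim!: eventually_mono)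
qed

end
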